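(* For every $\mu>0$ there exist a real $3\times3$ matrix-valued function $A=A_\mu(x,y,t)$ on $\mathbb{T}^2\times\mathbb{R}$, uniformly elliptic and uniformly $C^1$, and a non-zero real, uniformly $C^2$ function $u=u_\mu(x,y,t)$ on $\mathbb{T}^2\times\mathbb{R}$ such that $$\operatorname{div}(A\nabla u)=-\mu u\quad\text{in }\mathbb{T}^2\times\mathbb{R},$$ and $u$ has double exponential decay in both directions: there are constants $c=c(\mu)>0$, $C=C(\mu)>0$ such that for all sufficiently large $T$, $$\sup_{\mathbb{T}^2\times\{|t|\ge T\}}|u(x,y,t)|\le Ce^{-ce^{cT}}.$$
   Context: $\mathbb{T}^2=(\mathbb{R}/2\pi\mathbb{Z})^2$ with periodic coordinates $(x,y)$; $t\in\mathbb{R}$ is the third coordinate. $\nabla$ and $\operatorname{div}$ are taken in $(x,y,t)$. Uniformly elliptic: there is $\Lambda\ge1$ with $\Lambda^{-1}|\xi|^2\le\xi^TA\xi\le\Lambda|\xi|^2$ for all $\xi\in\mathbb{R}^3$ and all points. Uniformly $C^1$ (resp. $C^2$): all partial derivatives of order $\le1$ (resp. $\le2$) are continuous and bounded on the whole domain. *)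

theory Defs
  imports "HOL-Analysis.Analysis"
begin

text \<open>Points of T^2 x R are represented by their lifts p :: real^3 with
  p$1 = x, p$2 = y, p$3 = t; functions on T^2 x R are functions on real^3 that are
  2pi-periodic in the first two coordinates.\<close>

definition periodic_xy :: "(real^3 \<Rightarrow> 'a) \<Rightarrow> bool" where
  "periodic_xy f \<longleftrightarrow> (\<forall>p. f (p + (2*pi) *\<^sub>R axis 1 1) = f p \<and> f (p + (2*pi) *\<^sub>R axis 2 1) = f p)"

definition partial :: "(real^3 \<Rightarrow> real) \<Rightarrow> 3 \<Rightarrow> real^3 \<Rightarrow> real" where
  "partial f k p = deriv (\<lambda>s. f (p + s *\<^sub>R axis k 1)) 0"

definition has_partials :: "(real^3 \<Rightarrow> real) \<Rightarrow> bool" where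
  "has_partials f \<longleftrightarrow> (\<forall>k p. (\<lambda>s. f (p + s *\<^sub>R axis k 1)) differentiable (at 0))"

definition unif_C1 :: "(real^3 \<Rightarrow> real) \<Rightarrow> bool" where
  "unif_C1 f \<longleftrightarrow> has_partials f \<and> continuous_on UNIV f \<and> bounded (range f) \<and>
     (\<forall>k. continuous_on UNIV (partial f k) \<and> bounded (range (partial f k)))"

definition unif_C2 :: "(real^3 \<Rightarrow> real) \<Rightarrow> bool" where
  "unif_C2 f \<longleftrightarrow> unif_C1 f \<and> (\<forall>k. unif_C1 (partial f k))"

definition unif_elliptic :: "(real^3 \<Rightarrow> real^3^3) \<Rightarrow> bool" where
  "unif_elliptic A \<longleftrightarrow> (\<exists>\<Lambda>\<ge>1. \<forall>p \<xi>. norm \<xi> ^ 2 / \<Lambda> \<le> \<xi> \<bullet> (A p *v \<xi>) \<and> \<xi> \<bullet> (A p *v \<xi>) \<le> \<Lambda> * norm \<xi> ^ 2)"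

definition div_A_grad :: "(real^3 \<Rightarrow> real^3^3) \<Rightarrow> (real^3 \<Rightarrow> real) \<Rightarrow> real^3 \<Rightarrow> real" where
  "div_A_grad A u p = (\<Sum>i\<in>UNIV. partial (\<lambda>q. \<Sum>j\<in>UNIV. A q $ i $ j * partial u j q) i p)"

end

theory Submission
  imports Defs
begin

text \<open>Since \<open>A\<close> need not be symmetric, a flux \<open>V\<close> can be written as \<open>D \<nabla>u\<close> with \<open>D\<close> of size
  \<open>\<bar>V\<bar> / \<bar>\<nabla>u\<bar>\<close> wherever \<open>\<nabla>u\<close> does not vanish. For a large parameter \<open>L\<close> let
  \<open>s = 3/2 + ln (cosh (t / L))\<close>, an even function growing linearly. The solution is a chain of modes
  \<open>exp (- f\<^sub>n) cos (2\<^sup>n z)\<close>, where \<open>z\<close> is alternately \<open>x\<close> and \<open>y\<close> and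
  \<open>f\<^sub>n = L 2\<^sup>n g(s - n)\<close>. Consecutive modes oscillate in different directions, so a diagonal
  matrix depending only on \<open>t\<close> makes both of them exact solutions near \<open>s = n\<close>, where \<open>g\<close> is chosen
  such that mode \<open>n\<close> dominates for \<open>s < n\<close> and mode \<open>n + 1\<close> for \<open>s > n\<close>. Each mode is switched on and
  off while it is smaller than the dominating one by a factor \<open>exp (- L 2\<^sup>n / 10)\<close>. The resulting
  error is the divergence of an equally small flux, and the gradient of the dominating mode vanishes
  nowhere, so a tiny nonsymmetric correction of \<open>A\<close> removes it; the factor \<open>exp (- L 2\<^sup>n / 10)\<close>
  absorbs all powers of the frequency in the derivatives. Near \<open>t = 0\<close>, where the amplitude is concave,
  the term \<open>\<mu> u\<close> keeps the matrix elliptic.\<close>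

section \<open>Families of functions with uniform bounds\<close>

text \<open>The diagonal entry (f'^2 - f'' + \<mu>) / k^2 has to stay bounded above and below, which
  ties the decay rate f' to the frequency k. Hence the frequency must keep growing; doubling it once
  per unit of s gives exponents of order 2^(t/L). The obstacle is the hand-over: mode n + 1 has
  twice the frequency and yet must overtake mode n, so at s = n it has to decay more slowly. For
  exponents L 2^n g(s - n) this means g'(0) > 2 g'(-1) with g' > 0. For g' = 1 + a cos(pi v) the
  condition is 1/3 < a < 1, and a = 4/5 leaves room. The additive constant 2 in g places the
  crossing at s = n. The shift 3/2 in s puts t = 0 half a unit below the first crossing s = 2, where
  a single mode is present: there the t-derivative vanishes, the gradient does have zeros, and
  nothing may need correcting. The matrix sees u only through quotients by the dominating mode, so
  the absolute smallness of u does no harm. L is chosen last, after the constants of the corrections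
  and the lower bound of the diagonal; this is why every estimate has to be uniform in L as well as
  in n.\<close>

definition has_partial :: "(real^3 \<Rightarrow> real) \<Rightarrow> 3 \<Rightarrow> real^3 \<Rightarrow> real \<Rightarrow> bool" where
  "has_partial f k p d \<longleftrightarrow> ((\<lambda>s. f (p + s *\<^sub>R axis k 1)) has_real_derivative d) (at 0)"

lemma partial_eq: "has_partial f k p d \<Longrightarrow> partial f k p = d"
  unfolding has_partial_def partial_def by (rule DERIV_imp_deriv)

lemma has_partial_partial:
  "(\<lambda>s. f (p + s *\<^sub>R axis k 1)) differentiable (at 0) \<Longrightarrow> has_partial f k p (partial f k p)"
  unfolding has_partial_def partial_def
  by (metis DERIV_deriv_iff_real_differentiable)

lemma has_partial_differentiable:
  "has_partial f k p d \<Longrightarrow> (\<lambda>s. f (p + s *\<^sub>R axis k 1)) differentiable (at 0)"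
  unfolding has_partial_def using real_differentiable_def by blast

lemma eventually_line:
  assumes "open S" "p \<in> (S :: (real^3) set)"
  shows "\<forall>\<^sub>F s in nhds 0. p + s *\<^sub>R axis k 1 \<in> S"
proof -
  have "((\<lambda>s. p + s *\<^sub>R axis k 1) \<longlongrightarrow> p + (0::real) *\<^sub>R axis k 1) (nhds 0)"
    by (intro tendsto_intros filterlim_ident)
  then have "((\<lambda>s::real. p + s *\<^sub>R axis k 1) \<longlongrightarrow> p) (nhds 0)" by simp
  then show ?thesis using assms by (rule topological_tendstoD)
qed

lemma has_partial_cong:
  assumes "open S" "p \<in> S" "\<And>q. q \<in> S \<Longrightarrow> f q = g q" "has_partial f k p d"
  shows "has_partial g k p d"
proof -
  have "\<forall>\<^sub>F s in nhds 0. f (p + s *\<^sub>R axis k 1) = g (p + s *\<^sub>R axis k 1)"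
    using eventually_line[OF assms(1,2)] by eventually_elim (rule assms(3))
  with assms(4) show ?thesis
    unfolding has_partial_def by (subst (asm) DERIV_cong_ev) auto
qed

lemma partial_cong:
  assumes "open S" "p \<in> S" "\<And>q. q \<in> S \<Longrightarrow> f q = g q"
  shows "partial f k p = partial g k p"
proof -
  have "\<forall>\<^sub>F s in nhds 0. f (p + s *\<^sub>R axis k 1) = g (p + s *\<^sub>R axis k 1)"
    using eventually_line[OF assms(1,2)] by eventually_elim (rule assms(3))
  then show ?thesis unfolding partial_def by (rule deriv_cong_ev) auto
qed

lemma has_partial_add:
  "has_partial f k p a \<Longrightarrow> has_partial g k p b \<Longrightarrow> has_partial (\<lambda>q. f q + g q) k p (a + b)"
  unfolding has_partial_def by (rule DERIV_add)

lemma has_partial_mult: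
  "has_partial f k p a \<Longrightarrow> has_partial g k p b \<Longrightarrow>
    has_partial (\<lambda>q. f q * g q) k p (a * g p + f p * b)"
  unfolding has_partial_def by (auto dest: DERIV_mult' simp: algebra_simps)

lemma has_partial_coord:
  assumes "(f has_real_derivative d) (at (p $ j))"
  shows "has_partial (\<lambda>q. f (q $ j)) k p (if k = j then d else 0)"
proof (cases "k = j")
  case True
  have "((\<lambda>s. p $ j + s) has_real_derivative 1) (at 0)"
    by (auto intro!: derivative_eq_intros)
  then have "((\<lambda>s. f (p $ j + s)) has_real_derivative d * 1) (at 0)"
    using assms by (intro DERIV_chain2[where f=f]) auto
  then show ?thesis using True by (simp add: has_partial_def axis_def)
next
  case False
  then show ?thesis by (auto simp: has_partial_def axis_def)
qed

section \<open>Bounds uniform over an indexed family\<close>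

definition tame0 :: "('i \<Rightarrow> (real^3) set) \<Rightarrow> ('i \<Rightarrow> real) \<Rightarrow> ('i \<Rightarrow> real^3 \<Rightarrow> real) \<Rightarrow> bool" where
  "tame0 S w F \<longleftrightarrow> (\<forall>i. open (S i) \<and> continuous_on (S i) (F i)) \<and>
     (\<exists>C. \<forall>i. \<forall>p\<in>S i. \<bar>F i p\<bar> \<le> C * w i)"

text \<open>The constant in the bound is uniform in the index \<open>i\<close>; the same weight serves all partial
  derivatives of order at most \<open>r\<close>.\<close>
fun tame :: "nat \<Rightarrow> ('i \<Rightarrow> (real^3) set) \<Rightarrow> ('i \<Rightarrow> real) \<Rightarrow> ('i \<Rightarrow> real^3 \<Rightarrow> real) \<Rightarrow> bool" where
  "tame 0 S w F \<longleftrightarrow> tame0 S w F"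
| "tame (Suc r) S w F \<longleftrightarrow> tame0 S w F \<and>
     (\<forall>i. \<forall>p\<in>S i. \<forall>k. (\<lambda>s. F i (p + s *\<^sub>R axis k 1)) differentiable (at 0)) \<and>
     (\<forall>k. tame r S w (\<lambda>i. partial (F i) k))"

lemma tame_imp_tame0: "tame r S w F \<Longrightarrow> tame0 S w F"
  by (cases r) auto

lemma tame_open: "tame r S w F \<Longrightarrow> open (S i)"
  by (drule tame_imp_tame0) (simp add: tame0_def)

lemma tame_SucD: "tame (Suc r) S w F \<Longrightarrow> tame r S w F"
proof (induction r arbitrary: F)
  case (Suc r)
  then show ?case unfolding tame.simps(2)[of "Suc r"] tame.simps(2)[of r] by blast
qed simp

lemma tame_antimono: "tame r S w F \<Longrightarrow> r' \<le> r \<Longrightarrow> tame r' S w F"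
proof (induction "r - r'" arbitrary: r)
  case (Suc d)
  then obtain r0 where "r = Suc r0" "d = r0 - r'" "r' \<le> r0" by (cases r) auto
  with Suc show ?case using tame_SucD by blast
qed auto

lemma tame0_cong:
  assumes "tame0 S w F" "\<And>i p. p \<in> S i \<Longrightarrow> F i p = F' i p"
  shows "tame0 S w F'"
proof -
  have "continuous_on (S i) (F' i)" for i
    using assms continuous_on_cong[of "S i" "S i" "F i" "F' i"] by (auto simp: tame0_def)
  moreover have "\<exists>C. \<forall>i. \<forall>p\<in>S i. \<bar>F' i p\<bar> \<le> C * w i"
    using assms unfolding tame0_def by (metis (no_types, lifting))
  ultimately show ?thesis using assms(1) by (simp add: tame0_def)
qed

lemma tame_cong:
  assumes "tame r S w F" "\<And>i p. p \<in> S i \<Longrightarrow> F i p = F' i p"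
  shows "tame r S w F'"
  using assms
proof (induction r arbitrary: F F')
  case 0
  then show ?case using tame0_cong by fastforce
next
  case (Suc r)
  have op: "open (S i)" for i by (rule tame_open[OF Suc.prems(1)])
  have "(\<lambda>s. F' i (p + s *\<^sub>R axis k 1)) differentiable (at 0)" if "p \<in> S i" for i p k
    using has_partial_cong[OF op that Suc.prems(2) has_partial_partial] Suc.prems(1) that
      has_partial_differentiable by fastforce
  moreover have "tame r S w (\<lambda>i. partial (F' i) k)" for k
  proof (rule Suc.IH)
    show "tame r S w (\<lambda>i. partial (F i) k)" using Suc.prems(1) by simp
    show "partial (F i) k p = partial (F' i) k p" if "p \<in> S i" for i p
      by (rule partial_cong[OF op that Suc.prems(2)])
  qed
  moreover have "tame0 S w F'"
    by (rule tame0_cong[OF tame_imp_tame0[OF Suc.prems(1)] Suc.prems(2)])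
  ultimately show ?case unfolding tame.simps by blast
qed

lemma tame_SucI:
  assumes "tame0 S w F" "\<And>i p k. p \<in> S i \<Longrightarrow> has_partial (F i) k p (G k i p)"
    "\<And>k. tame r S w (G k)"
  shows "tame (Suc r) S w F"
proof -
  have "tame r S w (\<lambda>i. partial (F i) k)" for k
    by (rule tame_cong[OF assms(3)[of k]]) (use assms(2) partial_eq in metis)
  then show ?thesis
    using assms has_partial_differentiable by fastforce
qed

lemma tame_has_partial:
  "tame (Suc r) S w F \<Longrightarrow> p \<in> S i \<Longrightarrow> has_partial (F i) k p (partial (F i) k p)"
  unfolding tame.simps by (blast intro: has_partial_partial)

lemma tame_subset:
  assumes "tame r S w F" "\<And>i. S' i \<subseteq> S i" "\<And>i. open (S' i)"
  shows "tame r S' w F"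
  using assms(1)
proof (induction r arbitrary: F)
  case 0
  then show ?case using assms(2,3) unfolding tame.simps tame0_def
    by (meson continuous_on_subset subsetD)
next
  case (Suc r)
  have "tame0 S' w F" using Suc.prems assms(2,3) unfolding tame.simps tame0_def
    by (meson continuous_on_subset subsetD)
  then show ?case using Suc assms(2) by auto blast
qed

lemma tame0_Un:
  assumes "tame0 S w F" "tame0 S' w F" "\<And>i. T i \<subseteq> S i \<union> S' i" "\<And>i. open (T i)"
    "\<And>i. T i \<noteq> {} \<Longrightarrow> 0 \<le> w i"
  shows "tame0 T w F"
proof -
  obtain C C' where C: "\<And>i p. p \<in> S i \<Longrightarrow> \<bar>F i p\<bar> \<le> C * w i" "\<And>i p. p \<in> S' i \<Longrightarrow> \<bar>F i p\<bar> \<le> C' * w i"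
    using assms(1,2) unfolding tame0_def by metis
  have "\<bar>F i p\<bar> \<le> max C C' * w i" if "p \<in> T i" for i p
  proof -
    have "0 \<le> w i" using assms(5) that by auto
    then have "C * w i \<le> max C C' * w i" "C' * w i \<le> max C C' * w i"
      by (auto intro: mult_right_mono)
    then show ?thesis using C that assms(3)[of i] by (metis Un_iff order_trans subsetD)
  qed
  moreover have "continuous_on (T i) (F i)" for i
  proof -
    have "continuous_on (S i \<union> S' i) (F i)"
      using assms(1,2) by (intro continuous_on_open_Un) (auto simp: tame0_def)
    then show ?thesis using assms(3) continuous_on_subset by blast
  qed
  ultimately show ?thesis using assms(4) by (auto simp: tame0_def)
qed

lemma tame_Un:
  assumes "tame r S w F" "tame r S' w F" "\<And>i. T i \<subseteq> S i \<union> S' i" "\<And>i. open (T i)"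
    "\<And>i. T i \<noteq> {} \<Longrightarrow> 0 \<le> w i"
  shows "tame r T w F"
  using assms(1,2)
proof (induction r arbitrary: F)
  case 0
  then have "tame0 S w F" "tame0 S' w F" by auto
  from tame0_Un[of S w F S' T, OF this assms(3-5)] show ?case by simp
next
  case (Suc r)
  have "tame0 T w F"
    by (rule tame0_Un[of S w F S' T, OF Suc.prems[THEN tame_imp_tame0] assms(3-5)])
  then show ?case using Suc assms(3) by auto blast
qed

lemma tame0_weight:
  assumes "tame0 S w F" "\<And>i. S i \<noteq> {} \<Longrightarrow> 0 \<le> w i \<and> w i \<le> c * w' i"
  shows "tame0 S w' F"
proof -
  obtain C where C: "\<And>i p. p \<in> S i \<Longrightarrow> \<bar>F i p\<bar> \<le> C * w i"
    using assms unfolding tame0_def by metis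
  have "\<bar>F i p\<bar> \<le> (\<bar>C\<bar> * c) * w' i" if "p \<in> S i" for i p
  proof -
    have w: "0 \<le> w i \<and> w i \<le> c * w' i" using assms(2) that by blast
    have "C * w i \<le> \<bar>C\<bar> * w i" using w by (intro mult_right_mono) auto
    also have "\<dots> \<le> \<bar>C\<bar> * (c * w' i)" using w by (intro mult_left_mono) auto
    finally show ?thesis using C[OF that] by (simp add: mult.assoc)
  qed
  then show ?thesis using assms(1) unfolding tame0_def by blast
qed

lemma tame_weight:
  assumes "tame r S w F" "\<And>i. S i \<noteq> {} \<Longrightarrow> 0 \<le> w i \<and> w i \<le> c * w' i"
  shows "tame r S w' F"
  using assms(1)
proof (induction r arbitrary: F)
  case 0
  then show ?case using tame0_weight[OF _ assms(2)] by simp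
next
  case (Suc r)
  have "tame0 S w' F" using tame0_weight[OF tame_imp_tame0[OF Suc.prems] assms(2)] by auto
  then show ?case using Suc by auto
qed

lemma tame0_add:
  assumes "tame0 S w F" "tame0 S w G"
  shows "tame0 S w (\<lambda>i p. F i p + G i p)"
proof -
  obtain C D where C: "\<And>i p. p \<in> S i \<Longrightarrow> \<bar>F i p\<bar> \<le> C * w i" "\<And>i p. p \<in> S i \<Longrightarrow> \<bar>G i p\<bar> \<le> D * w i"
    using assms unfolding tame0_def by metis
  have "\<bar>F i p + G i p\<bar> \<le> (C + D) * w i" if "p \<in> S i" for i p
    using C[OF that] by (auto simp: algebra_simps)
  then show ?thesis using assms unfolding tame0_def by (auto intro!: continuous_on_add)
qed

lemma tame_add:
  assumes "tame r S w F" "tame r S w G"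
  shows "tame r S w (\<lambda>i p. F i p + G i p)"
  using assms
proof (induction r arbitrary: F G)
  case 0
  then show ?case using tame0_add by auto
next
  case (Suc r)
  show ?case
    by (rule tame_SucI[where G = "\<lambda>k i p. partial (F i) k p + partial (G i) k p"])
      (use Suc in \<open>auto intro!: has_partial_add has_partial_partial tame0_add\<close>)
qed

lemma tame0_mult:
  assumes "tame0 S w F" "tame0 S w' G" 
  shows "tame0 S (\<lambda>i. w i * w' i) (\<lambda>i p. F i p * G i p)"
proof -
  obtain C D where C: "\<And>i p. p \<in> S i \<Longrightarrow> \<bar>F i p\<bar> \<le> C * w i" "\<And>i p. p \<in> S i \<Longrightarrow> \<bar>G i p\<bar> \<le> D * w' i"
    using assms unfolding tame0_def by metis
  have "\<bar>F i p * G i p\<bar> \<le> (C * D) * (w i * w' i)" if "p \<in> S i" for i p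
  proof -
    have "\<bar>F i p * G i p\<bar> \<le> (C * w i) * (D * w' i)"
      unfolding abs_mult using C[OF that] by (intro mult_mono) auto
    then show ?thesis by (simp add: mult_ac)
  qed
  then show ?thesis using assms unfolding tame0_def by (auto intro!: continuous_on_mult)
qed

lemma tame_mult:
  assumes "tame r S w F" "tame r S w' G" 
  shows "tame r S (\<lambda>i. w i * w' i) (\<lambda>i p. F i p * G i p)"
  using assms
proof (induction r arbitrary: F G)
  case 0
  then show ?case using tame0_mult by auto
next
  case (Suc r)
  show ?case
  proof (rule tame_SucI[where G = "\<lambda>k i p. partial (F i) k p * G i p + F i p * partial (G i) k p"])
    show "tame r S (\<lambda>i. w i * w' i) (\<lambda>i p. partial (F i) k p * G i p + F i p * partial (G i) k p)" for k
      using Suc.IH Suc.prems tame_SucD[OF Suc.prems(1)] tame_SucD[OF Suc.prems(2)]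
      by (intro tame_add) auto
  qed (use Suc.prems in \<open>auto intro!: has_partial_mult has_partial_partial tame0_mult\<close>)
qed

lemma tame_const:
  assumes "\<And>i. open (S i)" "\<And>i. S i \<noteq> {} \<Longrightarrow> \<bar>c i\<bar> \<le> C * w i" "\<And>i. S i \<noteq> {} \<Longrightarrow> 0 \<le> w i"
  shows "tame r S w (\<lambda>i p. c i)"
proof -
  have 0: "tame r S w (\<lambda>i p. 0)" for r
  proof (induction r)
    case 0
    show ?case using assms(1) by (auto simp: tame0_def intro!: exI[of _ 0])
  next
    case (Suc r)
    show ?case by (rule tame_SucI[where G = "\<lambda>k i p. 0"])
        (use Suc tame_imp_tame0[OF Suc] in \<open>auto simp: has_partial_def\<close>)
  qed
  have 1: "tame0 S w (\<lambda>i p. c i)" using assms by (auto simp: tame0_def intro!: exI[of _ C])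
  show ?thesis
  proof (cases r)
    case (Suc r')
    show ?thesis unfolding Suc
      by (rule tame_SucI[where G = "\<lambda>k i p. 0"]) (use 0 1 in \<open>auto simp: has_partial_def\<close>)
  qed (use 1 in auto)
qed

lemma tame_coord:
  assumes "tame0 S w (\<lambda>i p. f i (p $ j))"
    "\<And>i p. p \<in> S i \<Longrightarrow> (f i has_real_derivative f' i (p $ j)) (at (p $ j))"
    "tame r S w (\<lambda>i p. f' i (p $ j))" "\<And>i. S i \<noteq> {} \<Longrightarrow> 0 \<le> w i"
  shows "tame (Suc r) S w (\<lambda>i p. f i (p $ j))"
proof (rule tame_SucI[where G = "\<lambda>k i p. if k = j then f' i (p $ j) else 0"])
  have "tame r S w (\<lambda>i p. 0)" by (rule tame_const[where C=0]) (use assms tame_open in auto)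
  then show "tame r S w (\<lambda>i p. if k = j then f' i (p $ j) else 0)" for k
    using assms(3) by (cases "k = j") simp_all
next
  show "has_partial (\<lambda>q. f i (q $ j)) k p (if k = j then f' i (p $ j) else 0)"
    if "p \<in> S i" for i p k
    by (rule has_partial_coord[OF assms(2)[OF that]])
qed (rule assms(1))

text \<open>Partial derivatives are local on open pieces, and the one constant in
  \<open>tame\<close> with weight 1 becomes the global bound. The subset \<open>I\<close> allows one
  parameter value to be picked from a family whose index also ranges over the parameter.\<close>

lemma unif_C1_glue:
  assumes "tame (Suc 0) S (\<lambda>_. 1) F" "(\<Union>i\<in>I. S i) = UNIV" "\<And>i p. i \<in> I \<Longrightarrow> p \<in> S i \<Longrightarrow> f p = F i p"
  shows "unif_C1 f"
proof -
  have op: "open (S i)" for i by (rule tame_open[OF assms(1)])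
  have hp: "has_partial f k p (partial (F i) k p)" if "i \<in> I" "p \<in> S i" for i p k
    by (rule has_partial_cong[OF op[of i] that(2), of "F i"])
      (use assms that in \<open>auto intro!: tame_has_partial[of 0]\<close>)
  have cont: "continuous_on UNIV g \<and> bounded (range g)"
    if g: "tame0 S (\<lambda>_. 1) G" "\<And>i p. i \<in> I \<Longrightarrow> p \<in> S i \<Longrightarrow> g p = G i p" for g and G :: "'a \<Rightarrow> real^3 \<Rightarrow> real"
  proof
    have "continuous_on (S i) g" if "i \<in> I" for i
      using g that continuous_on_cong[of "S i" "S i" g "G i"] by (auto simp: tame0_def)
    then have "continuous_on (\<Union>i\<in>I. S i) g" using op by (intro continuous_on_open_UN) auto
    then show "continuous_on UNIV g" using assms(2) by simp
    obtain C where "\<And>i p. p \<in> S i \<Longrightarrow> \<bar>G i p\<bar> \<le> C" using g(1) unfolding tame0_def by auto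
    then have "\<bar>g p\<bar> \<le> C" for p using g(2) assms(2) by (metis UNIV_I UN_E)
    then show "bounded (range g)" by (auto intro!: boundedI)
  qed
  have "continuous_on UNIV (partial f k) \<and> bounded (range (partial f k))" for k
    using hp assms(1) by (intro cont[of "\<lambda>i. partial (F i) k"]) (auto simp: partial_eq)
  moreover have "has_partials f" unfolding has_partials_def
    using hp has_partial_differentiable assms(2) by (metis UNIV_I UN_E)
  moreover have "tame0 S (\<lambda>_. 1) F" by (rule tame_imp_tame0[OF assms(1)])
  note cont[OF this assms(3)]
  ultimately show ?thesis unfolding unif_C1_def by blast
qed

lemma unif_C2_glue:
  assumes "tame (Suc (Suc 0)) S (\<lambda>_. 1) F" "(\<Union>i\<in>I. S i) = UNIV" "\<And>i p. i \<in> I \<Longrightarrow> p \<in> S i \<Longrightarrow> f p = F i p"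
  shows "unif_C2 f"
proof -
  have op: "open (S i)" for i by (rule tame_open[OF assms(1)])
  have "unif_C1 (partial f k)" for k
  proof (rule unif_C1_glue[OF _ assms(2)])
    show "tame (Suc 0) S (\<lambda>_. 1) (\<lambda>i. partial (F i) k)" using assms(1) by simp
    show "partial f k p = partial (F i) k p" if "i \<in> I" "p \<in> S i" for i p
      by (rule partial_cong[OF op[of i] that(2)]) (use assms(3) that in blast)
  qed
  moreover have "unif_C1 f" using unif_C1_glue[OF tame_SucD[OF assms(1)] assms(2,3)] .
  ultimately show ?thesis by (simp add: unif_C2_def)
qed

section \<open>Profiles in the time variable\<close>

definition clip :: "real \<Rightarrow> real" where "clip x = max 0 (min 1 x)"

text \<open>The constant extensions match to first order because \<open>f'\<close> vanishes at both
  junctions.\<close>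

lemma DERIV_clip:
  assumes f: "\<And>x. (f has_real_derivative f' x) (at x)" and 0: "f' 0 = 0" "f' 1 = 0"
  shows "((\<lambda>x. f (clip x)) has_real_derivative f' (clip x)) (at x)"
proof -
  consider "x < 0" | "x > 1" | "0 < x" "x < 1" | "x = 0 \<or> x = 1" by linarith
  then show ?thesis
  proof cases
    case 1
    have "((\<lambda>x. f 0) has_real_derivative 0) (at x)" by simp
    then have "((\<lambda>x. f (clip x)) has_real_derivative 0) (at x)"
      by (rule has_field_derivative_transform_within_open[where S = "{..<0}"]) (use 1 in \<open>auto simp: clip_def\<close>)
    then show ?thesis using 1 0 by (simp add: clip_def)
  next
    case 2
    have "((\<lambda>x. f 1) has_real_derivative 0) (at x)" by simp
    then have "((\<lambda>x. f (clip x)) has_real_derivative 0) (at x)"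
      by (rule has_field_derivative_transform_within_open[where S = "{1<..}"]) (use 2 in \<open>auto simp: clip_def\<close>)
    then show ?thesis using 2 0 by (simp add: clip_def)
  next
    case 3
    have "((\<lambda>x. f (clip x)) has_real_derivative f' x) (at x)"
      by (rule has_field_derivative_transform_within_open[OF f, where S = "{0<..<1}"]) (use 3 in \<open>auto simp: clip_def\<close>)
    then show ?thesis using 3 by (simp add: clip_def)
  next
    case 4
    then have x: "clip x = x" "f' x = 0" using 0 by (auto simp: clip_def)
    \<comment> \<open>Caratheodory's form of the derivative: the slope \<open>g\<close> tends to 0
      at the junction. Since \<open>clip\<close> fixes \<open>x\<close> and is 1-Lipschitz there,
      the difference quotient of the composition is at most \<open>g (clip z)\<close> in absolute
      value.\<close>
    obtain g where g: "\<And>z. f z - f x = g z * (z - x)" "isCont g x" "g x = 0"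
      using f[of x] unfolding CARAT_DERIV x by auto
    have lim: "((\<lambda>z. g (clip z)) \<longlongrightarrow> g (clip x)) (at x)"
    proof -
      have "isCont clip x" unfolding clip_def[abs_def] by (intro continuous_intros)
      then have "isCont (\<lambda>z. g (clip z)) x" using g(2) x by (intro isCont_o2[of x clip g]) auto
      then show ?thesis by (simp add: isCont_def)
    qed
    have "((\<lambda>z. (f (clip z) - f (clip x)) / (z - x)) \<longlongrightarrow> 0) (at x)"
    proof (rule Lim_null_comparison)
      have "norm ((f (clip z) - f (clip x)) / (z - x)) \<le> \<bar>g (clip z)\<bar>" for z
      proof (cases "z = x")
        case False
        have "\<bar>clip z - x\<bar> \<le> \<bar>z - x\<bar>" using 4 by (auto simp: clip_def)
        then have "\<bar>g (clip z)\<bar> * \<bar>clip z - x\<bar> \<le> \<bar>g (clip z)\<bar> * \<bar>z - x\<bar>" by (intro mult_left_mono) auto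
        then show ?thesis using False g(1)[of "clip z"] by (simp add: x abs_mult divide_le_eq)
      qed simp
      then show "\<forall>\<^sub>F z in at x. norm ((f (clip z) - f (clip x)) / (z - x)) \<le> \<bar>g (clip z)\<bar>" by simp
      show "((\<lambda>z. \<bar>g (clip z)\<bar>) \<longlongrightarrow> 0) (at x)"
        using tendsto_rabs[OF lim] x g(3) by simp
    qed
    then show ?thesis using x by (simp add: has_field_derivative_iff)
  qed
qed

text \<open>The first argument is the order of the derivative; every index from 3 on stands for the third
  derivative, so that the family is defined for all indices.\<close>
fun smoothstep_poly :: "nat \<Rightarrow> real \<Rightarrow> real" where
  "smoothstep_poly 0 y = 35 * y^4 - 84 * y^5 + 70 * y^6 - 20 * y^7"
| "smoothstep_poly (Suc 0) y = 140 * y^3 * (1 - y)^3"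
| "smoothstep_poly (Suc (Suc 0)) y = 420 * y\<^sup>2 * (1 - y)\<^sup>2 * (1 - 2 * y)"
| "smoothstep_poly (Suc (Suc (Suc _))) y = 840 * y * (1 - y) * (1 - 5 * y + 5 * y\<^sup>2)"

text \<open>Degree 7 gives vanishing derivatives up to order 3 at both ends, so the step is C^3:
  second derivatives of cutoffs enter the matrix, which must be C^1. The factor 140 is the
  reciprocal of the integral of y^3 (1 - y)^3 over [0, 1].\<close>

definition smoothstep :: "nat \<Rightarrow> real \<Rightarrow> real" where "smoothstep j x = smoothstep_poly j (clip x)"

lemma smoothstep_poly_fun:
  "smoothstep_poly 0 = (\<lambda>y. 35 * y^4 - 84 * y^5 + 70 * y^6 - 20 * y^7)"
  "smoothstep_poly (Suc 0) = (\<lambda>y. 140 * y^3 * (1 - y)^3)"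
  "smoothstep_poly (Suc (Suc 0)) = (\<lambda>y. 420 * y\<^sup>2 * (1 - y)\<^sup>2 * (1 - 2 * y))"
  "smoothstep_poly (Suc (Suc (Suc m))) = (\<lambda>y. 840 * y * (1 - y) * (1 - 5 * y + 5 * y\<^sup>2))"
  by (simp_all add: fun_eq_iff)

lemma DERIV_smoothstep:
  assumes "j < 3"
  shows "(smoothstep j has_real_derivative smoothstep (Suc j) x) (at x)"
proof -
  have "j = 0 \<or> j = Suc 0 \<or> j = Suc (Suc 0)" using assms by auto
  then have "(smoothstep_poly j has_real_derivative smoothstep_poly (Suc j) y) (at y)" for y
    by (elim disjE; hypsubst; simp only: smoothstep_poly_fun;
        auto intro!: derivative_eq_intros simp: algebra_simps power_numeral_reduce)
  moreover have "smoothstep_poly (Suc j) 0 = 0" "smoothstep_poly (Suc j) 1 = 0"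
    by (cases "(j, 0::real)" rule: smoothstep_poly.cases; simp)+
  ultimately show ?thesis unfolding smoothstep_def[abs_def] by (rule DERIV_clip)
qed

lemma smoothstep_const: "x \<le> 0 \<Longrightarrow> smoothstep j x = 0" "x \<ge> 1 \<Longrightarrow> smoothstep (Suc j) x = 0" "x \<ge> 1 \<Longrightarrow> smoothstep 0 x = 1"
  by (cases "(j, 0::real)" rule: smoothstep_poly.cases; auto simp: smoothstep_def clip_def)+

lemma smoothstep_poly_continuous: "continuous_on UNIV (smoothstep_poly j)"
  by (cases "(j, 0::real)" rule: smoothstep_poly.cases)
    (auto simp del: smoothstep_poly.simps simp: smoothstep_poly_fun intro!: continuous_intros)

lemma smoothstep_continuous: "continuous_on UNIV (smoothstep j)"
proof -
  have "continuous_on UNIV clip" unfolding clip_def[abs_def] by (intro continuous_intros)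
  then show ?thesis unfolding smoothstep_def[abs_def]
    by (rule continuous_on_compose2[OF smoothstep_poly_continuous]) auto
qed

lemma smoothstep_bounded: "\<exists>C. \<forall>x. \<bar>smoothstep j x\<bar> \<le> C"
proof -
  have "bounded (smoothstep_poly j ` {0..1})"
    by (intro compact_imp_bounded compact_continuous_image continuous_on_subset[OF smoothstep_poly_continuous]) auto
  then obtain C where "\<forall>y\<in>{0..1}. \<bar>smoothstep_poly j y\<bar> \<le> C" by (auto simp: bounded_iff)
  moreover have "clip x \<in> {0..1}" for x by (simp add: clip_def)
  ultimately have "\<bar>smoothstep j x\<bar> \<le> C" for x unfolding smoothstep_def by blast
  then show ?thesis by blast
qed

lemma smoothstep_0_range: "0 \<le> smoothstep 0 x" "smoothstep 0 x \<le> 1"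
proof -
  have m: "smoothstep 0 a \<le> smoothstep 0 b" if "a \<le> b" for a b
  proof (rule DERIV_nonneg_imp_nondecreasing[OF that])
    fix x
    have "0 \<le> smoothstep (Suc 0) x" by (auto simp: smoothstep_def clip_def)
    then show "\<exists>y. (smoothstep 0 has_real_derivative y) (at x) \<and> 0 \<le> y" using DERIV_smoothstep[of 0 x] by auto
  qed
  show "0 \<le> smoothstep 0 x" using m[of "min 0 x" x] by (simp add: smoothstep_const)
  show "smoothstep 0 x \<le> 1" using m[of x "max 1 x"] by (simp add: smoothstep_const)
qed

text \<open>The transition between consecutive modes is symmetric because
  \<open>profile v - 2 * profile (v - 1)\<close> is odd; the sine makes it change sign at \<open>v = 0\<close> from
  negative to positive, while the derivative \<open>rho\<close> keeps period 2, the distance of two modes that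
  oscillate in the same direction.\<close>
definition profile :: "real \<Rightarrow> real" where "profile v = 2 + v + 4 / (5 * pi) * sin (pi * v)"
definition rho :: "real \<Rightarrow> real" where "rho v = 1 + 4 / 5 * cos (pi * v)"
definition rho1 :: "real \<Rightarrow> real" where "rho1 v = - (4 * pi / 5 * sin (pi * v))"
definition slow :: "real \<Rightarrow> real \<Rightarrow> real" where "slow L t = 3/2 + ln (cosh (t / L))"

section \<open>The exponent profile and the gap between neighbouring modes\<close>

lemma DERIV_profile: "(profile has_real_derivative rho v) (at v)"
  unfolding profile_def[abs_def] rho_def by (auto intro!: derivative_eq_intros simp: field_simps)

lemma DERIV_rho: "(rho has_real_derivative rho1 v) (at v)"
  unfolding rho_def[abs_def] rho1_def by (auto intro!: derivative_eq_intros simp: field_simps)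

lemma rho_bounds: "1/5 \<le> rho v" "rho v \<le> 2" "\<bar>rho1 v\<bar> \<le> 4"
proof -
  show "1/5 \<le> rho v" "rho v \<le> 2" using cos_ge_minus_one[of "pi * v"] cos_le_one[of "pi * v"]
    unfolding rho_def by linarith+
  have "\<bar>rho1 v\<bar> = 4 * pi / 5 * \<bar>sin (pi * v)\<bar>" by (simp add: rho1_def abs_mult)
  also have "\<dots> \<le> 4 * pi / 5 * 1" by (intro mult_left_mono) auto
  also have "\<dots> \<le> 4" using pi_less_4 by simp
  finally show "\<bar>rho1 v\<bar> \<le> 4" .
qed

lemma rho_periodic: "rho (v - 2) = rho v" "rho1 (v - 2) = rho1 v"
  by (simp_all add: rho_def rho1_def right_diff_distrib cos_diff sin_diff mult.commute[of pi 2])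

lemma profile_lower: "profile v \<ge> 26/15 + v"
proof -
  have "\<bar>4 / (5 * pi) * sin (pi * v)\<bar> \<le> 4 / (5 * pi) * 1"
    unfolding abs_mult by (intro mult_mono) auto
  also have "\<dots> \<le> 4/15" using pi_gt3 by (simp add: field_simps)
  finally show ?thesis unfolding profile_def by linarith
qed

text \<open>The difference has derivative cos y - (1 - y^2/2), which is nonnegative by the
  half-angle formula and |sin x| \<le> |x|.\<close>

lemma sin_lower: "0 \<le> x \<Longrightarrow> x - x^3/6 \<le> sin (x::real)"
proof -
  assume x: "0 \<le> x"
  have "sin 0 - (0 - 0^3/6) \<le> sin x - (x - x^3/6)"
  proof (rule DERIV_nonneg_imp_nondecreasing[OF x])
    fix y :: real
    have "((\<lambda>y. sin y - (y - y^3/6)) has_real_derivative (cos y - (1 - y\<^sup>2/2))) (at y)"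
      by (auto intro!: derivative_eq_intros simp: power2_eq_square)
    moreover have "0 \<le> cos y - (1 - y\<^sup>2/2)"
    proof -
      have "(sin (y/2))\<^sup>2 \<le> (y/2)\<^sup>2" using abs_sin_x_le_abs_x[of "y/2"] unfolding abs_le_square_iff .
      moreover have "cos y = 1 - 2 * (sin (y/2))\<^sup>2" using cos_double_sin[of "y/2"] by simp
      ultimately show ?thesis by (simp add: power_divide)
    qed
    ultimately show "\<exists>d. ((\<lambda>y. sin y - (y - y^3/6)) has_real_derivative d) (at y) \<and> 0 \<le> d" by blast
  qed
  then show ?thesis by simp
qed

text \<open>A constant c in place of 2 would leave 2 - c behind. The shift by 1 reverses the sine,
  so the two sine terms add up to three times the original amplitude.\<close>

lemma profile_shift: "profile v - 2 * profile (v - 1) = 12 / (5 * pi) * sin (pi * v) - v"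
  by (simp add: profile_def right_diff_distrib sin_diff field_simps)

text \<open>Times L 2^n this is the difference of the exponents of modes n and n + 1, so the 1/10
  here is the one in \<open>decay\<close>. The interval leaves a margin on both sides of [1/6, 1/4],
  where the switching takes place.\<close>

lemma profile_gap_pos:
  assumes "1/8 < v" "v < 1/3"
  shows "profile v - 2 * profile (v - 1) \<ge> 1/10"
proof -
  have "pi\<^sup>2 \<le> 10"
  proof -
    have "pi \<le> 3.15" by (rule order_trans[OF pi_approx(2)]) simp
    then have "pi\<^sup>2 \<le> 3.15\<^sup>2" by (intro power_mono) auto
    then show ?thesis by (simp add: power2_eq_square)
  qed
  moreover have "v\<^sup>2 \<le> 1/9" using power_mono[of v "1/3" 2] assms by (simp add: power_divide)
  ultimately have b: "pi\<^sup>2 * v\<^sup>2 \<le> 10 * (1/9)" by (intro mult_mono) auto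
  have "12 / (5 * pi) * sin (pi * v) \<ge> 12 / (5 * pi) * (pi * v - (pi * v)^3/6)"
    using assms by (intro mult_left_mono sin_lower) auto
  also have "12 / (5 * pi) * (pi * v - (pi * v)^3/6) = v * (12/5 - 2/5 * (pi\<^sup>2 * v\<^sup>2))"
    by (simp add: field_simps power2_eq_square power3_eq_cube)
  finally have "profile v - 2 * profile (v - 1) \<ge> v * (7/5 - 2/5 * (pi\<^sup>2 * v\<^sup>2))"
    unfolding profile_shift by (simp add: algebra_simps)
  \<comment> \<open>The factor becomes 7/5 - 4/9 = 43/45, and 43/45 * 1/8 still exceeds
    1/10.\<close>
  moreover have "v * (7/5 - 2/5 * (pi\<^sup>2 * v\<^sup>2)) \<ge> v * (7/5 - 2/5 * (10 * (1/9)))"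
    using b assms by (intro mult_left_mono) auto
  ultimately have "profile v - 2 * profile (v - 1) \<ge> v * (7/5 - 2/5 * (10 * (1/9)))" by (rule order_trans[rotated])
  then show ?thesis using assms by simp
qed

lemma profile_gap_neg:
  assumes "1/8 < - v" "- v < 1/3"
  shows "2 * profile (v - 1) - profile v \<ge> 1/10"
  using profile_gap_pos[OF assms] profile_shift[of v] profile_shift[of "-v"] by simp

section \<open>The slow time variable\<close>

lemma DERIV_slow:
  assumes "L \<noteq> 0"
  shows "(slow L has_real_derivative tanh (t / L) / L) (at t)"
proof -
  have "((\<lambda>t. cosh (t / L)) has_real_derivative sinh (t / L) * (1 / L)) (at t)"
    by (rule has_field_derivative_cosh[OF DERIV_cdivide[OF DERIV_ident]])
  from DERIV_ln_divide[THEN DERIV_chain2, OF cosh_real_pos this]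
  have "((\<lambda>t. 3/2 + ln (cosh (t / L))) has_real_derivative
      0 + 1 / cosh (t / L) * (sinh (t / L) * (1 / L))) (at t)"
    by (intro DERIV_add DERIV_const)
  then show ?thesis by (simp add: slow_def[abs_def] tanh_def)
qed

lemma DERIV_tanh_scaled:
  assumes "L \<noteq> 0"
  shows "((\<lambda>t. tanh (t / L)) has_real_derivative (1 - (tanh (t / L))\<^sup>2) / L) (at t)"
proof -
  have "((\<lambda>t. tanh (t / L)) has_real_derivative (1 - (tanh (t / L))\<^sup>2) * (1 / L)) (at t)"
    by (rule has_field_derivative_tanh[OF _ DERIV_cdivide[OF DERIV_ident]]) simp
  then show ?thesis by simp
qed

lemma abs_tanh_le: "\<bar>tanh (x::real)\<bar> \<le> 1"
  using tanh_real_lt_1[of x] tanh_real_gt_neg1[of x] by auto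

lemma tanh_sq_le: "(tanh (x::real))\<^sup>2 \<le> 1"
  using abs_tanh_le[of x] by (simp add: abs_square_le_1)

lemma slow_continuous: "L \<noteq> 0 \<Longrightarrow> continuous_on UNIV (slow L)"
  by (rule DERIV_continuous_on) (rule DERIV_slow)

lemma slow_ge: "slow L t \<ge> 3/2"
  unfolding slow_def using cosh_real_ge_1[of "t/L"] by simp

text \<open>cosh (t/L) = exp (s - 3/2) is at least 1 + (s - 3/2), and tanh^2 = 1 - 1/cosh^2. The
  decay rate of each mode carries the factor tanh (t/L); this keeps it away from 0 once s is away
  from 3/2.\<close>

lemma tanh_sq_slow: "(tanh (t / L))\<^sup>2 \<ge> 1 - 1 / (1 + (slow L t - 3/2))\<^sup>2"
proof -
  let ?c = "cosh (t / L)" and ?s = "slow L t - 3/2"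
  have c: "?c > 0" by (rule cosh_real_pos)
  have "1 + ?s \<le> exp ?s" by (rule exp_ge_add_one_self)
  also have "exp ?s = ?c" using c by (simp add: slow_def)
  finally have "1 + ?s \<le> ?c" .
  then have "(1 + ?s)\<^sup>2 \<le> ?c\<^sup>2" "0 < (1 + ?s)\<^sup>2" using slow_ge[of L t] by (auto intro!: power_mono)
  then have "1 / ?c\<^sup>2 \<le> 1 / (1 + ?s)\<^sup>2" by (intro divide_left_mono) auto
  moreover have "(tanh (t / L))\<^sup>2 = 1 - 1 / ?c\<^sup>2"
  proof -
    have "(tanh (t / L))\<^sup>2 = (?c\<^sup>2 - 1) / ?c\<^sup>2"
      by (simp add: tanh_def power_divide cosh_square_eq)
    then show ?thesis using c by (simp add: diff_divide_distrib)
  qed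
  ultimately show ?thesis by simp
qed

section \<open>Weights\<close>

text \<open>The outer function comes with its chain of derivatives, since each differentiation turns
  \<open>\<phi> j\<close> into \<open>\<phi> (Suc j)\<close>. The limit \<open>R\<close>
  accommodates finite smoothness, as for \<open>smoothstep\<close>.\<close>

lemma tame_comp:
  assumes "\<And>j x. j < R \<Longrightarrow> (\<phi> j has_real_derivative \<phi> (Suc j) x) (at x)"
    "\<And>j. continuous_on UNIV (\<phi> j)" "\<And>j. \<exists>C. \<forall>x. \<bar>\<phi> j x\<bar> \<le> C"
    and F: "tame r S (\<lambda>_. 1) F" and "j + r \<le> R"
  shows "tame r S (\<lambda>_. 1) (\<lambda>i p. \<phi> j (F i p))"
  using F \<open>j + r \<le> R\<close>
proof (induction r arbitrary: j)
  case 0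
  then have "tame0 S (\<lambda>_. 1) F" by simp
  then show ?case using assms(3)[of j] continuous_on_compose2[OF assms(2)[of j]]
    by (auto simp: tame0_def)
next
  case (Suc r)
  have 0: "tame0 S (\<lambda>_. 1) (\<lambda>i p. \<phi> j (F i p))"
    using tame_imp_tame0[OF Suc.prems(1)] assms(3)[of j] continuous_on_compose2[OF assms(2)[of j]]
    by (auto simp: tame0_def)
  show ?case
  proof (rule tame_SucI[where G = "\<lambda>k i p. \<phi> (Suc j) (F i p) * partial (F i) k p", OF 0])
    fix i p k assume p: "p \<in> S i"
    have 1: "((\<lambda>s. F i (p + s *\<^sub>R axis k 1)) has_real_derivative partial (F i) k p) (at 0)"
      using tame_has_partial[OF Suc.prems(1) p] by (simp add: has_partial_def)
    have 2: "(\<phi> j has_real_derivative \<phi> (Suc j) (F i p)) (at (F i (p + 0 *\<^sub>R axis k 1)))"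
      using assms(1)[of j "F i p"] Suc.prems(2) by simp
    show "has_partial (\<lambda>p. \<phi> j (F i p)) k p (\<phi> (Suc j) (F i p) * partial (F i) k p)"
      unfolding has_partial_def by (rule DERIV_chain2[OF 2 1])
  next
    fix k
    have "tame r S (\<lambda>i. 1 * 1) (\<lambda>i p. \<phi> (Suc j) (F i p) * partial (F i) k p)"
      using Suc by (intro tame_mult Suc.IH tame_SucD[OF Suc.prems(1)]) auto
    then show "tame r S (\<lambda>_. 1) (\<lambda>i p. \<phi> (Suc j) (F i p) * partial (F i) k p)" by simp
  qed
qed

text \<open>The index \<open>(L, n)\<close> carries the parameter \<open>L\<close>, so that all constants are independent of \<open>L\<close>;
  the strips with \<open>L < 1\<close> are empty and impose nothing.\<close>
definition strip :: "real \<times> nat \<Rightarrow> (real^3) set" where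
  "strip i = {p. 1 \<le> fst i \<and> 2 \<le> snd i \<and> \<bar>slow (fst i) (p $ 3) - real (snd i)\<bar> < 5/8}"

definition freq :: "real \<times> nat \<Rightarrow> real" where "freq i = 2 ^ snd i"
definition decay :: "real \<times> nat \<Rightarrow> real" where "decay i = exp (- (fst i * 2 ^ snd i / 10))"

text \<open>Each derivative may cost powers of the frequency, so the exponent \<open>m\<close> is
  left open. Only the number \<open>j\<close> of exponentially small factors matters, because one of
  them already beats every \<open>m\<close>. Being inside the strips forces L \<ge> 1, hence
  \<open>decay\<close> \<le> 1.\<close>

definition cls :: "nat \<Rightarrow> nat \<Rightarrow> (real \<times> nat \<Rightarrow> (real^3) set) \<Rightarrow> (real \<times> nat \<Rightarrow> real^3 \<Rightarrow> real) \<Rightarrow> bool" where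
  "cls j r S F \<longleftrightarrow> (\<forall>i. S i \<subseteq> strip i) \<and> (\<exists>m. tame r S (\<lambda>i. freq i ^ m * decay i ^ j) F)"

lemma freq_ge_1: "1 \<le> freq i" by (simp add: freq_def)

lemma decay_pos: "0 < decay i" by (simp add: decay_def)

lemma decay_le_1: "S i \<subseteq> strip i \<Longrightarrow> S i \<noteq> {} \<Longrightarrow> decay i \<le> 1"
  by (auto simp: decay_def strip_def)

lemma tame_raise:
  assumes "tame r S (\<lambda>i. freq i ^ m * decay i ^ j) F" "m \<le> m'" "j' \<le> j" "\<And>i. S i \<subseteq> strip i"
  shows "tame r S (\<lambda>i. freq i ^ m' * decay i ^ j') F"
proof (rule tame_weight[where c = 1, OF assms(1)])
  fix i assume ne: "S i \<noteq> {}"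
  have "freq i ^ m \<le> freq i ^ m'" using freq_ge_1 assms(2) by (intro power_increasing) auto
  moreover have "decay i ^ j \<le> decay i ^ j'"
    using decay_le_1[of S i] decay_pos[of i] assms(3,4) ne by (intro power_decreasing) auto
  ultimately show "0 \<le> freq i ^ m * decay i ^ j \<and> freq i ^ m * decay i ^ j \<le> 1 * (freq i ^ m' * decay i ^ j')"
    using freq_ge_1[of i] decay_pos[of i] by (auto intro!: mult_mono mult_nonneg_nonneg)
qed

lemma cls_mono: "cls j r S F \<Longrightarrow> j' \<le> j \<Longrightarrow> cls j' r S F"
  unfolding cls_def using tame_raise[of r S _ j F _ j'] by blast

lemma cls_antimono: "cls j r S F \<Longrightarrow> r' \<le> r \<Longrightarrow> cls j r' S F"
  unfolding cls_def using tame_antimono by blast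

lemma cls_cong: "cls j r S F \<Longrightarrow> (\<And>i p. p \<in> S i \<Longrightarrow> F i p = F' i p) \<Longrightarrow> cls j r S F'"
  unfolding cls_def using tame_cong[of r S _ F F'] by blast

lemma cls_subset: "cls j r S F \<Longrightarrow> (\<And>i. S' i \<subseteq> S i) \<Longrightarrow> (\<And>i. open (S' i)) \<Longrightarrow> cls j r S' F"
  unfolding cls_def using tame_subset[of r S _ F S'] by blast

lemma cls_Un:
  assumes "cls j r S F" "cls j r S' F" "\<And>i. T i \<subseteq> S i \<union> S' i" "\<And>i. open (T i)"
  shows "cls j r T F"
proof -
  obtain m m' where m: "tame r S (\<lambda>i. freq i ^ m * decay i ^ j) F" "tame r S' (\<lambda>i. freq i ^ m' * decay i ^ j) F"
    and s: "\<And>i. S i \<subseteq> strip i" "\<And>i. S' i \<subseteq> strip i"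
    using assms(1,2) unfolding cls_def by blast
  have "tame r T (\<lambda>i. freq i ^ max m m' * decay i ^ j) F"
    by (rule tame_Un[OF tame_raise[OF m(1), of "max m m'" j] tame_raise[OF m(2), of "max m m'" j] assms(3,4)])
      (use s freq_ge_1 decay_pos in \<open>auto intro!: mult_nonneg_nonneg zero_le_power simp: less_imp_le order_trans[OF zero_le_one]\<close>)
  moreover have "T i \<subseteq> strip i" for i using assms(3) s by blast
  ultimately show ?thesis unfolding cls_def by blast
qed

lemma cls_add:
  assumes "cls j r S F" "cls j r S G"
  shows "cls j r S (\<lambda>i p. F i p + G i p)"
proof -
  obtain m m' where m: "tame r S (\<lambda>i. freq i ^ m * decay i ^ j) F" "tame r S (\<lambda>i. freq i ^ m' * decay i ^ j) G"
    and s: "\<And>i. S i \<subseteq> strip i"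
    using assms unfolding cls_def by blast
  have "tame r S (\<lambda>i. freq i ^ max m m' * decay i ^ j) (\<lambda>i p. F i p + G i p)"
    by (rule tame_add[OF tame_raise[OF m(1), of "max m m'" j] tame_raise[OF m(2), of "max m m'" j]])
      (use s in auto)
  then show ?thesis unfolding cls_def using s by blast
qed

lemma cls_mult:
  assumes "cls j r S F" "cls j' r S G"
  shows "cls (j + j') r S (\<lambda>i p. F i p * G i p)"
proof -
  obtain m m' where m: "tame r S (\<lambda>i. freq i ^ m * decay i ^ j) F" "tame r S (\<lambda>i. freq i ^ m' * decay i ^ j') G"
    and s: "\<And>i. S i \<subseteq> strip i"
    using assms unfolding cls_def by blast
  have "tame r S (\<lambda>i. freq i ^ (m + m') * decay i ^ (j + j')) (\<lambda>i p. F i p * G i p)"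
    using tame_mult[OF m] by (simp add: power_add mult_ac)
  then show ?thesis unfolding cls_def using s by blast
qed

lemma cls_mult00: "cls 0 r S F \<Longrightarrow> cls 0 r S G \<Longrightarrow> cls 0 r S (\<lambda>i p. F i p * G i p)"
  using cls_mult[of 0 r S F 0 G] by simp

lemma cls_mult01: "cls 0 r S F \<Longrightarrow> cls 1 r S G \<Longrightarrow> cls 1 r S (\<lambda>i p. F i p * G i p)"
  using cls_mult[of 0 r S F 1 G] by simp

lemma cls_mult10: "cls 1 r S F \<Longrightarrow> cls 0 r S G \<Longrightarrow> cls 1 r S (\<lambda>i p. F i p * G i p)"
  using cls_mult[of 1 r S F 0 G] by simp

lemma cls_const:
  assumes "\<And>i. S i \<subseteq> strip i" "\<And>i. open (S i)" "\<And>i. S i \<noteq> {} \<Longrightarrow> \<bar>c i\<bar> \<le> C * freq i"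
  shows "cls 0 r S (\<lambda>i p. c i)"
proof -
  have "tame r S (\<lambda>i. freq i ^ 1 * decay i ^ 0) (\<lambda>i p. c i)"
    by (rule tame_const[where C = C])
      (use assms freq_ge_1 in \<open>auto simp: order_trans[OF zero_le_one]\<close>)
  then show ?thesis unfolding cls_def using assms by blast
qed

lemma cls_of_bounded:
  assumes "tame r S (\<lambda>_. 1) F" "\<And>i. S i \<subseteq> strip i"
  shows "cls 0 r S F"
proof -
  have "tame r S (\<lambda>i. freq i ^ 0 * decay i ^ 0) F" using assms(1) by simp
  then show ?thesis unfolding cls_def using assms(2) by blast
qed

lemma cls_open: "cls j r S F \<Longrightarrow> open (S i)"
  unfolding cls_def using tame_open by metis

lemma cls_strip: "cls j r S F \<Longrightarrow> S i \<subseteq> strip i"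
  unfolding cls_def by blast

lemma cls_SucI:
  assumes "cls j 0 S F" "\<And>i p k. p \<in> S i \<Longrightarrow> has_partial (F i) k p (G k i p)" "\<And>k. cls j r S (G k)"
  shows "cls j (Suc r) S F"
proof -
  have s: "\<And>i. S i \<subseteq> strip i" using cls_strip assms(1) by blast
  obtain m0 where m0: "tame 0 S (\<lambda>i. freq i ^ m0 * decay i ^ j) F" using assms(1) unfolding cls_def by blast
  obtain m where m: "\<And>k. tame r S (\<lambda>i. freq i ^ m k * decay i ^ j) (G k)"
    using assms(3) unfolding cls_def by metis
  \<comment> \<open>One frequency exponent that dominates those of the function and of all three
    partial derivatives.\<close>
  define M where "M = m0 + (\<Sum>k\<in>UNIV. m k)"
  have le: "m k \<le> M" for k unfolding M_def using member_le_sum[of k UNIV m] by auto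
  have "tame (Suc r) S (\<lambda>i. freq i ^ M * decay i ^ j) F"
  proof (rule tame_SucI[OF _ assms(2)])
    have "tame 0 S (\<lambda>i. freq i ^ M * decay i ^ j) F"
      by (rule tame_raise[OF m0]) (use s in \<open>auto simp: M_def\<close>)
    then show "tame0 S (\<lambda>i. freq i ^ M * decay i ^ j) F" by simp
    show "tame r S (\<lambda>i. freq i ^ M * decay i ^ j) (G k)" for k
      by (rule tame_raise[OF m le]) (use s in auto)
  qed
  then show ?thesis unfolding cls_def using s by blast
qed

text \<open>The coordinate \<open>l i\<close> depends on the index because the direction of a mode
  alternates with n.\<close>

lemma cls_coord:
  assumes "cls j 0 S (\<lambda>i p. f i (p $ l i))"
    "\<And>i p. p \<in> S i \<Longrightarrow> (f i has_real_derivative f' i (p $ l i)) (at (p $ l i))"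
    "cls j r S (\<lambda>i p. f' i (p $ l i))"
  shows "cls j (Suc r) S (\<lambda>i p. f i (p $ l i))"
proof (rule cls_SucI[OF assms(1)])
  show "has_partial (\<lambda>q. f i (q $ l i)) k p ((if k = l i then 1 else 0) * f' i (p $ l i))"
    if "p \<in> S i" for i p k
    using has_partial_coord[OF assms(2)[OF that], of k] by (cases "k = l i") simp_all
  have "cls 0 r S (\<lambda>i p. if k = l i then 1 else 0)" for k
  proof (rule cls_const[where C = 1])
    show "\<bar>if k = l i then 1 else 0\<bar> \<le> 1 * freq i" for i using freq_ge_1[of i] by auto
  qed (rule cls_strip[OF assms(1)] cls_open[OF assms(1)])+
  from cls_mult[OF this assms(3)]
  show "cls j r S (\<lambda>i p. (if k = l i then 1 else 0) * f' i (p $ l i))" for k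
    by simp
qed

text \<open>If f' = q f with q of polynomial size in the frequency, every derivative is such a
  factor times f. Thus the size of f alone controls all orders.\<close>

lemma cls_exp_type:
  assumes "cls j 0 S (\<lambda>i p. f i (p $ l))"
    "\<And>i p. p \<in> S i \<Longrightarrow> (f i has_real_derivative q i (p $ l) * f i (p $ l)) (at (p $ l))"
    "\<And>r. cls 0 r S (\<lambda>i p. q i (p $ l))"
  shows "cls j r S (\<lambda>i p. f i (p $ l))"
proof (induction r)
  case (Suc r)
  show ?case
    by (rule cls_coord[where f = f and l = "\<lambda>_. l" and f' = "\<lambda>i t. q i t * f i t", OF assms(1,2)])
      (use cls_mult[OF assms(3) Suc] in auto)
qed (rule assms(1))

text \<open>The bound \<open>c\<close> is the same for all indices, so the reciprocal is bounded by
  1/c; the derivative - F' / F^2 then stays in the class by induction.\<close>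

lemma cls_inverse:
  assumes "cls 0 r S F" "\<And>i p. p \<in> S i \<Longrightarrow> c \<le> \<bar>F i p\<bar>" "0 < c"
  shows "cls 0 r S (\<lambda>i p. 1 / F i p)"
proof -
  have ne: "F i p \<noteq> 0" if "p \<in> S i" for i p using assms(2)[OF that] assms(3) by auto
  have "cls 0 0 S F" using assms(1) cls_antimono by blast
  then have "tame0 S (\<lambda>_. 1) (\<lambda>i p. 1 / F i p)"
    unfolding cls_def tame.simps tame0_def
    using ne assms(2,3) by (auto intro!: continuous_intros exI[of _ "1 / c"] divide_left_mono)
  then have 0: "cls 0 0 S (\<lambda>i p. 1 / F i p)"
    using cls_strip[OF assms(1)] by (intro cls_of_bounded) auto
  show ?thesis using assms(1)
  proof (induction r)
    case 0
    show ?case by (rule \<open>cls 0 0 S (\<lambda>i p. 1 / F i p)\<close>)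
  next
    case (Suc r)
    have IH: "cls 0 r S (\<lambda>i p. 1 / F i p)" using Suc cls_antimono[of 0 "Suc r" S F r] by auto
    obtain m where m: "tame (Suc r) S (\<lambda>i. freq i ^ m * decay i ^ 0) F" using Suc.prems unfolding cls_def by blast
    have G: "cls 0 r S (\<lambda>i. partial (F i) k)" for k
      using m cls_strip[OF assms(1)] unfolding cls_def tame.simps by blast
    have neg: "cls 0 r S (\<lambda>i p. - 1)"
      by (rule cls_const[where C = 1]) (use cls_open[OF 0] cls_strip[OF 0] freq_ge_1 in auto)
    show ?case
    proof (rule cls_SucI[where G = "\<lambda>k i p. - 1 * (partial (F i) k p * (1 / F i p * (1 / F i p)))", OF 0])
      fix i p k assume p: "p \<in> S i"
      have "((\<lambda>s. F i (p + s *\<^sub>R axis k 1)) has_real_derivative partial (F i) k p) (at 0)"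
        using tame_has_partial[OF m p] by (simp add: has_partial_def)
      then show "has_partial (\<lambda>p. 1 / F i p) k p (- 1 * (partial (F i) k p * (1 / F i p * (1 / F i p))))"
        unfolding has_partial_def using ne[OF p]
        by (auto intro!: derivative_eq_intros simp: field_simps)
    qed (intro cls_mult00 neg G IH)
  qed
qed

text \<open>A single term of the exponential series bounds exp x from below.\<close>

lemma exp_minus_le_fact:
  assumes "0 < (x::real)"
  shows "exp (- x) \<le> fact n / x ^ n"
proof -
  have "(\<lambda>n. x ^ n /\<^sub>R fact n) sums exp x" by (rule exp_converges)
  then have "(\<Sum>n. x ^ n /\<^sub>R fact n) = exp x" "summable (\<lambda>n. x ^ n /\<^sub>R fact n)"
    by (auto simp: sums_iff)
  moreover from this(2) have "(\<Sum>n\<in>{n}. x ^ n /\<^sub>R fact n) \<le> (\<Sum>n. x ^ n /\<^sub>R fact n)"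
    by (rule sum_le_suminf) (use assms in \<open>auto intro!: mult_nonneg_nonneg zero_le_power\<close>)
  ultimately have "x ^ n / fact n \<le> exp x" by (simp add: divide_inverse mult.commute)
  then have "inverse (exp x) \<le> inverse (x ^ n / fact n)"
    using assms by (intro le_imp_inverse_le) auto
  then show ?thesis by (simp add: exp_minus)
qed

text \<open>The series term of order m + 1 absorbs the m powers of the frequency and leaves at least
  one factor L in the denominator. This 1/L is what later makes the corrections small uniformly in
  n.\<close>

lemma poly_exp_decay: "\<exists>C. \<forall>i. 1 \<le> fst i \<longrightarrow> freq i ^ m * decay i \<le> C / fst i"
proof (intro exI allI impI)
  fix i :: "real \<times> nat" assume L: "1 \<le> fst i"
  define l k f where "l = fst i" "k = freq i" "f = (fact (Suc m) :: real)"
  have p: "1 \<le> l" "1 \<le> k" "0 < f" using L freq_ge_1 by (auto simp: l_k_f_def)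
  then have lk: "0 < l * k / 10" by simp
  have pow: "(l * k / 10) ^ Suc m = (l ^ Suc m * k) * k ^ m / 10 ^ Suc m"
    by (simp add: power_mult_distrib power_divide)
  have "decay i = exp (- (l * k / 10))" by (simp add: decay_def freq_def l_k_f_def)
  also have "\<dots> \<le> f / (l * k / 10) ^ Suc m"
    unfolding l_k_f_def(3) by (rule exp_minus_le_fact[OF lk])
  finally have "k ^ m * decay i \<le> k ^ m * (f / (l * k / 10) ^ Suc m)" using p by (intro mult_left_mono) auto
  also have "\<dots> = f * 10 ^ Suc m / (l ^ Suc m * k)" unfolding pow using p by simp
  also have "\<dots> \<le> f * 10 ^ Suc m / l"
  proof (rule divide_left_mono)
    have "l ^ 1 * 1 \<le> l ^ Suc m * k"
      using p by (intro mult_mono power_increasing) auto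
    then show "l \<le> l ^ Suc m * k" by simp
    show "0 < (l ^ Suc m * k) * l" using p by (intro mult_pos_pos zero_less_power) auto
    show "0 \<le> f * 10 ^ Suc m" using p by simp
  qed
  finally show "freq i ^ m * decay i \<le> fact (Suc m) * 10 ^ Suc m / fst i" unfolding l_k_f_def .
qed

lemma cls_1_small:
  assumes "cls 1 r S F"
  shows "\<exists>C>0. \<forall>i. \<forall>p\<in>S i. \<bar>F i p\<bar> \<le> C / fst i"
proof -
  have s: "\<And>i. S i \<subseteq> strip i" using cls_strip assms by blast
  obtain m where "tame r S (\<lambda>i. freq i ^ m * decay i ^ 1) F" using assms unfolding cls_def by blast
  then obtain C where C: "\<And>i p. p \<in> S i \<Longrightarrow> \<bar>F i p\<bar> \<le> C * (freq i ^ m * decay i)"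
    using tame_imp_tame0[of r S _ F] unfolding tame0_def by fastforce
  obtain D where D: "\<And>i. 1 \<le> fst i \<Longrightarrow> freq i ^ m * decay i \<le> D / fst i" using poly_exp_decay by blast
  have "\<bar>F i p\<bar> \<le> (\<bar>C\<bar> * \<bar>D\<bar> + 1) / fst i" if p: "p \<in> S i" for i p
  proof -
    have L: "1 \<le> fst i" using p s[of i] by (auto simp: strip_def)
    have n: "0 \<le> freq i ^ m * decay i" using freq_ge_1[of i] decay_pos[of i] by simp
    have "\<bar>F i p\<bar> \<le> \<bar>C\<bar> * (freq i ^ m * decay i)"
      using C[OF p] n mult_right_mono[of C "\<bar>C\<bar>" "freq i ^ m * decay i"] by linarith
    also have "\<dots> \<le> \<bar>C\<bar> * (\<bar>D\<bar> / fst i)"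
    proof (rule mult_left_mono)
      have "D / fst i \<le> \<bar>D\<bar> / fst i" using L by (intro divide_right_mono) auto
      then show "freq i ^ m * decay i \<le> \<bar>D\<bar> / fst i" using D[OF L] by linarith
    qed auto
    also have "\<dots> \<le> (\<bar>C\<bar> * \<bar>D\<bar> + 1) / fst i" using L by (simp add: field_simps)
    finally show ?thesis .
  qed
  moreover have "0 < \<bar>C\<bar> * \<bar>D\<bar> + 1" by (simp add: add_nonneg_pos)
  ultimately show ?thesis by blast
qed

lemma cls_1_bounded: "cls 1 r S F \<Longrightarrow> tame r S (\<lambda>_. 1) F"
proof -
  assume F: "cls 1 r S F"
  have s: "\<And>i. S i \<subseteq> strip i" using cls_strip F by blast
  obtain m where m: "tame r S (\<lambda>i. freq i ^ m * decay i ^ 1) F" using F unfolding cls_def by blast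
  obtain D where D: "\<And>i. 1 \<le> fst i \<Longrightarrow> freq i ^ m * decay i \<le> D / fst i" using poly_exp_decay by blast
  show ?thesis
  proof (rule tame_weight[where c = "\<bar>D\<bar>", OF m])
    fix i assume "S i \<noteq> {}"
    then have L: "1 \<le> fst i" using s[of i] by (auto simp: strip_def)
    have "D / fst i \<le> \<bar>D\<bar> / 1" using L by (intro frac_le) auto
    then show "0 \<le> freq i ^ m * decay i ^ 1 \<and> freq i ^ m * decay i ^ 1 \<le> \<bar>D\<bar> * 1"
      using D[OF L] freq_ge_1[of i] decay_pos[of i] by simp
  qed
qed

section \<open>Modes and coefficients\<close>

text \<open>With f = L 2^N profile (s - N), \<open>expo\<close> is exp (- f), \<open>rate\<close> is
  f' and \<open>rate1\<close> is f''. Below, the suffixes 1 and 2 mark first and second derivatives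
  in t, and \<open>err\<close> collects the terms of \<open>amp2\<close> in which the cutoff is
  differentiated.\<close>

definition expo :: "real \<Rightarrow> nat \<Rightarrow> real \<Rightarrow> real" where
  "expo L N t = exp (- (L * 2 ^ N * profile (slow L t - real N)))"
definition rate :: "real \<Rightarrow> nat \<Rightarrow> real \<Rightarrow> real" where
  "rate L N t = 2 ^ N * rho (slow L t - real N) * tanh (t / L)"
definition rate1 :: "real \<Rightarrow> nat \<Rightarrow> real \<Rightarrow> real" where
  "rate1 L N t = 2 ^ N / L * (rho1 (slow L t - real N) * (tanh (t / L))\<^sup>2
     + rho (slow L t - real N) * (1 - (tanh (t / L))\<^sup>2))"
text \<open>For c = 12 it rises from 0 to 1 as s - n runs from -1/4 to -1/6 (incoming mode); for c =
  -12 it falls from 1 to 0 between 1/6 and 1/4 (outgoing mode).\<close>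

definition cutoff :: "real \<Rightarrow> real \<Rightarrow> nat \<Rightarrow> real \<Rightarrow> real" where
  "cutoff c L n t = smoothstep 0 (3 + c * (slow L t - real n))"
definition cutoff1 :: "real \<Rightarrow> real \<Rightarrow> nat \<Rightarrow> real \<Rightarrow> real" where
  "cutoff1 c L n t = smoothstep (Suc 0) (3 + c * (slow L t - real n)) * (c / L * tanh (t / L))"
definition cutoff2 :: "real \<Rightarrow> real \<Rightarrow> nat \<Rightarrow> real \<Rightarrow> real" where
  "cutoff2 c L n t = smoothstep (Suc (Suc 0)) (3 + c * (slow L t - real n)) * (c / L * tanh (t / L))\<^sup>2
     + smoothstep (Suc 0) (3 + c * (slow L t - real n)) * (c / L * ((1 - (tanh (t / L))\<^sup>2) / L))"
definition amp :: "real \<Rightarrow> real \<Rightarrow> nat \<Rightarrow> nat \<Rightarrow> real \<Rightarrow> real" where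
  "amp c L n N t = cutoff c L n t * expo L N t"
definition amp1 :: "real \<Rightarrow> real \<Rightarrow> nat \<Rightarrow> nat \<Rightarrow> real \<Rightarrow> real" where
  "amp1 c L n N t = (cutoff1 c L n t - cutoff c L n t * rate L N t) * expo L N t"
definition amp2 :: "real \<Rightarrow> real \<Rightarrow> nat \<Rightarrow> nat \<Rightarrow> real \<Rightarrow> real" where
  "amp2 c L n N t = (cutoff2 c L n t - 2 * cutoff1 c L n t * rate L N t
     - cutoff c L n t * rate1 L N t + cutoff c L n t * (rate L N t)\<^sup>2) * expo L N t"
definition err :: "real \<Rightarrow> real \<Rightarrow> nat \<Rightarrow> nat \<Rightarrow> real \<Rightarrow> real" where
  "err c L n N t = (cutoff2 c L n t - 2 * cutoff1 c L n t * rate L N t) * expo L N t"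

text \<open>In place of \<open>1 / 2 ^ N\<close>: the values agree while mode \<open>N\<close> is present, and change to the
  value for the next mode in the same direction when no mode in that direction is present.\<close>
definition kapA :: "real \<Rightarrow> nat \<Rightarrow> real \<Rightarrow> real" where
  "kapA L n t = (1 - 3/4 * smoothstep 0 (2 * (slow L t - real n) - 1/2)) / 2 ^ n"
definition kapB :: "real \<Rightarrow> nat \<Rightarrow> real \<Rightarrow> real" where
  "kapB L n t = 2 * (1 - 3/4 * smoothstep 0 (2 * (slow L t - real n) + 3/2)) / 2 ^ n"
text \<open>The mode \<open>E = exp (- f)\<close> with frequency \<open>k\<close> solves \<open>E'' + \<mu> E = k\<^sup>2 \<alpha> E\<close> for
  \<open>\<alpha> = (f'\<^sup>2 - f'' + \<mu>) / k\<^sup>2\<close>.\<close>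
definition coeff :: "real \<Rightarrow> real \<Rightarrow> nat \<Rightarrow> (real \<Rightarrow> real) \<Rightarrow> real \<Rightarrow> real" where
  "coeff \<mu> L N \<kappa> t = (rho (slow L t - real N) * tanh (t / L))\<^sup>2
     - \<kappa> t / L * (rho1 (slow L t - real N) * (tanh (t / L))\<^sup>2
       + rho (slow L t - real N) * (1 - (tanh (t / L))\<^sup>2)) + \<mu> * (\<kappa> t)\<^sup>2"

section \<open>Time derivatives and the equation of a switched mode\<close>

lemma DERIV_slow_shift: "L \<noteq> 0 \<Longrightarrow> ((\<lambda>t. slow L t - c) has_real_derivative tanh (t / L) / L) (at t)"
  using DERIV_diff[OF DERIV_slow DERIV_const] by simp

lemma DERIV_expo: "L \<noteq> 0 \<Longrightarrow> (expo L N has_real_derivative - rate L N t * expo L N t) (at t)"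
proof -
  assume L: "L \<noteq> 0"
  note d = DERIV_chain2[OF DERIV_profile DERIV_slow_shift[OF L, of "real N" t]]
  have "((\<lambda>t. exp (- (L * 2 ^ N * profile (slow L t - real N)))) has_real_derivative
    exp (- (L * 2 ^ N * profile (slow L t - real N))) * - (L * 2 ^ N * (rho (slow L t - real N) * (tanh (t / L) / L)))) (at t)"
    by (rule DERIV_chain2[OF DERIV_exp DERIV_minus[OF DERIV_cmult[OF d]]])
  then show ?thesis using L by (simp add: expo_def[abs_def] rate_def mult_ac)
qed

lemma DERIV_rate: "L \<noteq> 0 \<Longrightarrow> (rate L N has_real_derivative rate1 L N t) (at t)"
proof -
  assume L: "L \<noteq> 0"
  note d = DERIV_chain2[OF DERIV_rho DERIV_slow_shift[OF L, of "real N" t]]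
  have "((\<lambda>t. 2 ^ N * rho (slow L t - real N) * tanh (t / L)) has_real_derivative
     2 ^ N * (rho1 (slow L t - real N) * (tanh (t / L) / L)) * tanh (t / L)
     + (1 - (tanh (t / L))\<^sup>2) / L * (2 ^ N * rho (slow L t - real N))) (at t)"
    by (rule DERIV_mult[OF DERIV_cmult[OF d] DERIV_tanh_scaled[OF L]])
  moreover have "2 ^ N * (rho1 (slow L t - real N) * (tanh (t / L) / L)) * tanh (t / L)
     + (1 - (tanh (t / L))\<^sup>2) / L * (2 ^ N * rho (slow L t - real N)) = rate1 L N t"
    using L by (simp add: rate1_def field_simps power2_eq_square)
  ultimately show ?thesis by (simp add: rate_def[abs_def])
qed

lemma DERIV_cutoff_arg:
  "L \<noteq> 0 \<Longrightarrow> ((\<lambda>t. 3 + c * (slow L t - real n)) has_real_derivative c / L * tanh (t / L)) (at t)"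
  using DERIV_add[OF DERIV_const DERIV_cmult[OF DERIV_slow_shift]] by simp

lemma DERIV_cutoff: "L \<noteq> 0 \<Longrightarrow> (cutoff c L n has_real_derivative cutoff1 c L n t) (at t)"
  unfolding cutoff_def[abs_def] cutoff1_def
  using DERIV_chain2[OF DERIV_smoothstep DERIV_cutoff_arg, of 0 L c n t] by simp

lemma DERIV_cutoff1: "L \<noteq> 0 \<Longrightarrow> (cutoff1 c L n has_real_derivative cutoff2 c L n t) (at t)"
proof -
  assume L: "L \<noteq> 0"
  have "((\<lambda>t. smoothstep (Suc 0) (3 + c * (slow L t - real n)) * (c / L * tanh (t / L))) has_real_derivative
     (smoothstep (Suc (Suc 0)) (3 + c * (slow L t - real n)) * (c / L * tanh (t / L))) * (c / L * tanh (t / L))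
     + (c / L * ((1 - (tanh (t / L))\<^sup>2) / L)) * smoothstep (Suc 0) (3 + c * (slow L t - real n))) (at t)"
    by (rule DERIV_mult[OF DERIV_chain2[OF DERIV_smoothstep DERIV_cutoff_arg[OF L]] DERIV_cmult[OF DERIV_tanh_scaled[OF L]]]) simp
  then show ?thesis by (simp add: cutoff1_def[abs_def] cutoff2_def power2_eq_square mult_ac)
qed

lemma DERIV_amp: "L \<noteq> 0 \<Longrightarrow> (amp c L n N has_real_derivative amp1 c L n N t) (at t)"
proof -
  assume L: "L \<noteq> 0"
  have "amp1 c L n N t = cutoff1 c L n t * expo L N t + - rate L N t * expo L N t * cutoff c L n t"
    by (simp add: amp1_def algebra_simps)
  then show ?thesis using DERIV_mult[OF DERIV_cutoff[OF L] DERIV_expo[OF L]] by (simp add: amp_def[abs_def])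
qed

lemma DERIV_amp1: "L \<noteq> 0 \<Longrightarrow> (amp1 c L n N has_real_derivative amp2 c L n N t) (at t)"
proof -
  assume L: "L \<noteq> 0"
  have "amp2 c L n N t = (cutoff2 c L n t - (cutoff1 c L n t * rate L N t + rate1 L N t * cutoff c L n t)) * expo L N t
    + - rate L N t * expo L N t * (cutoff1 c L n t - cutoff c L n t * rate L N t)"
    by (simp add: amp2_def algebra_simps power2_eq_square)
  then show ?thesis
    using DERIV_mult[OF DERIV_diff[OF DERIV_cutoff1[OF L] DERIV_mult[OF DERIV_cutoff[OF L] DERIV_rate[OF L]]] DERIV_expo[OF L]]
    by (simp add: amp1_def[abs_def])
qed

text \<open>For \<kappa> = 1/2^N the uncut mode solves its equation exactly, so only terms with a
  differentiated cutoff survive. Where the cutoff vanishes, all other terms drop out and \<kappa> is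
  free.\<close>

lemma amp_ode:
  assumes "cutoff c L n t = 0 \<or> \<kappa> t = 1 / 2 ^ N"
  shows "amp2 c L n N t - 2 ^ N * 2 ^ N * coeff \<mu> L N \<kappa> t * amp c L n N t = err c L n N t - \<mu> * amp c L n N t"
  using assms
proof
  assume k: "\<kappa> t = 1 / 2 ^ N"
  have "2 ^ N * 2 ^ N * coeff \<mu> L N \<kappa> t = (rate L N t)\<^sup>2 - rate1 L N t + \<mu>"
  proof -
    have "q * q * (a\<^sup>2 - 1 / q / L * X + \<mu> * (1 / q)\<^sup>2) = (q * a)\<^sup>2 - q / L * X + \<mu>" if "q \<noteq> 0" for q a X :: real
      using that by (simp add: power2_eq_square algebra_simps)
    from this[of "2 ^ N"] show ?thesis by (simp add: coeff_def rate_def rate1_def k mult.assoc)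
  qed
  then have "2 ^ N * 2 ^ N * coeff \<mu> L N \<kappa> t * amp c L n N t = ((rate L N t)\<^sup>2 - rate1 L N t + \<mu>) * amp c L n N t"
    by (rule arg_cong)
  then show ?thesis by (simp add: amp2_def amp_def err_def algebra_simps)
qed (simp add: amp2_def amp_def err_def)

section \<open>Uniform estimates of the profiles and modes on the strips\<close>

lemma strip_open: "open (strip i)"
proof (cases "1 \<le> fst i \<and> 2 \<le> snd i")
  case True
  then have "continuous_on UNIV (\<lambda>p::real^3. slow (fst i) (p $ 3))"
    by (intro continuous_on_compose2[OF slow_continuous[of "fst i"]] continuous_intros) auto
  then show ?thesis unfolding strip_def using True
    by (auto intro!: open_Collect_less continuous_intros)
qed (auto simp: strip_def)

lemma strip_ne: "strip i \<noteq> {} \<Longrightarrow> 1 \<le> fst i" by (auto simp: strip_def)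

lemma unit_tame_const: "(\<And>i. 1 \<le> fst i \<Longrightarrow> \<bar>c i\<bar> \<le> C) \<Longrightarrow> tame r strip (\<lambda>_. 1) (\<lambda>i p. c i)"
  by (rule tame_const[where C = C]) (use strip_open strip_ne in auto)

lemma unit_tame_num: "tame r strip (\<lambda>_. 1) (\<lambda>i p. c)"
  by (rule unit_tame_const[where C = "\<bar>c\<bar>"]) simp

lemma unit_tame_mult:
  "tame r S (\<lambda>_. 1) F \<Longrightarrow> tame r S (\<lambda>_. 1) G \<Longrightarrow> tame r S (\<lambda>_. 1) (\<lambda>i p. F i p * G i p)"
  using tame_mult[of r S "\<lambda>_. 1" F "\<lambda>_. 1" G] by simp

lemma unit_tame_minus: "tame r strip (\<lambda>_. 1) F \<Longrightarrow> tame r strip (\<lambda>_. 1) (\<lambda>i p. - F i p)"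
  using unit_tame_mult[OF unit_tame_const[of "\<lambda>_. -1" 1], of r F] by simp

lemma unit_tame_diff:
  "tame r strip (\<lambda>_. 1) F \<Longrightarrow> tame r strip (\<lambda>_. 1) G \<Longrightarrow> tame r strip (\<lambda>_. 1) (\<lambda>i p. F i p - G i p)"
  using tame_add[OF _ unit_tame_minus, of r F G] by simp

lemma unit_tame_power2:
  "tame r S (\<lambda>_. 1) F \<Longrightarrow> tame r S (\<lambda>_. 1) (\<lambda>i p. (F i p)\<^sup>2)"
  using unit_tame_mult[of r S F F] by (simp add: power2_eq_square)

lemma unit_tame_inverse_L: "tame r strip (\<lambda>_. 1) (\<lambda>i p. 1 / fst i)"
  by (rule unit_tame_const[where C = 1]) auto

lemma unit_tame_tanh: "tame r strip (\<lambda>_. 1) (\<lambda>i p. tanh (p $ 3 / fst i))"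
proof (induction r)
  case 0
  have "continuous_on (strip i) (\<lambda>p. tanh (p $ 3 / fst i))" for i
  proof (cases "strip i = {}")
    case False
    then have "fst i \<noteq> 0" using strip_ne[of i] by auto
    then show ?thesis by (intro continuous_intros) auto
  qed simp
  then show ?case using strip_open abs_tanh_le by (auto simp: tame0_def intro!: exI[of _ 1])
next
  case (Suc r)
  have "tame r strip (\<lambda>_. 1) (\<lambda>i p. (1 - (tanh (p $ 3 / fst i))\<^sup>2) * (1 / fst i))"
    by (intro unit_tame_mult unit_tame_diff unit_tame_power2 unit_tame_inverse_L Suc unit_tame_num)
  show ?case
  proof (rule tame_coord[where f = "\<lambda>i t. tanh (t / fst i)" and j = 3 and f' = "\<lambda>i t. (1 - (tanh (t / fst i))\<^sup>2) * (1 / fst i)",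
        OF tame_imp_tame0[OF Suc] _ \<open>tame r strip (\<lambda>_. 1) (\<lambda>i p. (1 - (tanh (p $ 3 / fst i))\<^sup>2) * (1 / fst i))\<close>])
    show "((\<lambda>t. tanh (t / fst i)) has_real_derivative (1 - (tanh (p $ 3 / fst i))\<^sup>2) * (1 / fst i)) (at (p $ 3))"
      if "p \<in> strip i" for i p
      using DERIV_tanh_scaled[of "fst i" "p $ 3"] that by (simp add: strip_def)
  qed simp
qed

lemma unit_tame_phase: "tame r strip (\<lambda>_. 1) (\<lambda>i p. slow (fst i) (p $ 3) - real (snd i))"
proof -
  have "continuous_on (strip i) (\<lambda>p. slow (fst i) (p $ 3) - real (snd i))" for i
  proof (cases "strip i = {}")
    case False
    then have "fst i \<noteq> 0" using strip_ne[of i] by auto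
    then show ?thesis
      by (intro continuous_intros continuous_on_compose2[OF slow_continuous[of "fst i"]]) auto
  qed simp
  then have 0: "tame0 strip (\<lambda>_. 1) (\<lambda>i p. slow (fst i) (p $ 3) - real (snd i))"
    using strip_open by (auto simp: tame0_def strip_def intro!: exI[of _ 1])
  show ?thesis
  proof (cases r)
    case (Suc r')
    have d: "tame r' strip (\<lambda>_. 1) (\<lambda>i p. tanh (p $ 3 / fst i) * (1 / fst i))"
      by (intro unit_tame_mult unit_tame_tanh unit_tame_inverse_L)
    show ?thesis unfolding Suc
    proof (rule tame_coord[where f = "\<lambda>i t. slow (fst i) t - real (snd i)" and j = 3 and f' = "\<lambda>i t. tanh (t / fst i) * (1 / fst i)",
          OF 0 _ d])
      show "((\<lambda>t. slow (fst i) t - real (snd i)) has_real_derivative tanh (p $ 3 / fst i) * (1 / fst i)) (at (p $ 3))"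
        if "p \<in> strip i" for i p
        using DERIV_slow_shift[of "fst i" "real (snd i)" "p $ 3"] that by (simp add: strip_def)
    qed simp
  qed (use 0 in simp)
qed

lemma unit_tame_affine_phase: "tame r strip (\<lambda>_. 1) (\<lambda>i p. b + a * (slow (fst i) (p $ 3) - real (snd i)))"
  by (intro tame_add unit_tame_mult unit_tame_phase unit_tame_num)

lemma unit_tame_smoothstep:
  "j + r \<le> 3 \<Longrightarrow> tame r strip (\<lambda>_. 1) (\<lambda>i p. smoothstep j (b + a * (slow (fst i) (p $ 3) - real (snd i))))"
  by (rule tame_comp[where \<phi> = smoothstep and R = 3, OF DERIV_smoothstep smoothstep_continuous smoothstep_bounded unit_tame_affine_phase])

lemma unit_tame_sin: "tame r strip (\<lambda>_. 1) (\<lambda>i p. sin (b + a * (slow (fst i) (p $ 3) - real (snd i))))"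
proof -
  \<comment> \<open>Writing derivatives of the sine as phase shifts by pi/2 yields one indexed
    chain, as \<open>tame_comp\<close> expects.\<close>
  define \<phi> where "\<phi> j x = sin (x + real j * (pi / 2))" for j x
  have "tame r strip (\<lambda>_. 1) (\<lambda>i p. \<phi> 0 (b + a * (slow (fst i) (p $ 3) - real (snd i))))"
  proof (rule tame_comp[where R = r, OF _ _ _ unit_tame_affine_phase])
    fix j x
    have "((\<lambda>x. sin (x + real j * (pi / 2))) has_real_derivative cos (x + real j * (pi / 2))) (at x)"
      by (auto intro!: derivative_eq_intros)
    moreover have "cos (x + real j * (pi / 2)) = \<phi> (Suc j) x"
    proof -
      have "x + real (Suc j) * (pi / 2) = (x + real j * (pi / 2)) + pi / 2" by (simp add: algebra_simps)
      then show ?thesis unfolding \<phi>_def by (simp only: sin_add) simp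
    qed
    ultimately show "(\<phi> j has_real_derivative \<phi> (Suc j) x) (at x)" by (simp add: \<phi>_def[abs_def])
    show "continuous_on UNIV (\<phi> j)" unfolding \<phi>_def[abs_def] by (intro continuous_intros)
    show "\<exists>C. \<forall>x. \<bar>\<phi> j x\<bar> \<le> C" unfolding \<phi>_def by (intro exI[of _ 1]) simp
  qed auto
  then show ?thesis by (simp add: \<phi>_def)
qed

lemma unit_tame_rho: "tame r strip (\<lambda>_. 1) (\<lambda>i p. rho (slow (fst i) (p $ 3) - real (snd i + e)))"
proof -
  have "tame r strip (\<lambda>_. 1) (\<lambda>i p. 1 + 4/5 * sin ((pi / 2 - pi * real e) + pi * (slow (fst i) (p $ 3) - real (snd i))))"
    by (intro tame_add unit_tame_mult unit_tame_sin unit_tame_num)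
  then show ?thesis
  proof (rule tame_cong)
    fix i :: "real \<times> nat" and p :: "real^3"
    let ?x = "pi * (slow (fst i) (p $ 3) - real (snd i + e))"
    have "(pi / 2 - pi * real e) + pi * (slow (fst i) (p $ 3) - real (snd i)) = pi / 2 + ?x"
      by (simp add: algebra_simps)
    then show "1 + 4/5 * sin ((pi / 2 - pi * real e) + pi * (slow (fst i) (p $ 3) - real (snd i)))
        = rho (slow (fst i) (p $ 3) - real (snd i + e))"
      unfolding rho_def by (simp only: sin_add) simp
  qed
qed

lemma unit_tame_rho1: "tame r strip (\<lambda>_. 1) (\<lambda>i p. rho1 (slow (fst i) (p $ 3) - real (snd i + e)))"
proof -
  have "tame r strip (\<lambda>_. 1) (\<lambda>i p. - (4 * pi / 5) * sin ((- (pi * real e)) + pi * (slow (fst i) (p $ 3) - real (snd i))))"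
    by (intro unit_tame_mult unit_tame_sin unit_tame_num)
  then show ?thesis
    by (rule tame_cong) (simp add: rho1_def algebra_simps)
qed

lemma unit_tame_inverse_freq: "tame r strip (\<lambda>_. 1) (\<lambda>i p. 1 / 2 ^ snd i)"
  by (rule unit_tame_const[where C = 1]) simp

lemma unit_tame_kapA: "r \<le> 3 \<Longrightarrow> tame r strip (\<lambda>_. 1) (\<lambda>i p. kapA (fst i) (snd i) (p $ 3))"
proof -
  assume r: "r \<le> 3"
  have "tame r strip (\<lambda>_. 1) (\<lambda>i p. (1 / 2 ^ snd i) * (1 - 3/4 * smoothstep 0 (- 1/2 + 2 * (slow (fst i) (p $ 3) - real (snd i)))))"
    using r by (intro unit_tame_mult unit_tame_inverse_freq unit_tame_diff unit_tame_smoothstep unit_tame_num) auto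
  then show ?thesis by (rule tame_cong) (simp add: kapA_def)
qed

lemma unit_tame_kapB: "r \<le> 3 \<Longrightarrow> tame r strip (\<lambda>_. 1) (\<lambda>i p. kapB (fst i) (snd i) (p $ 3))"
proof -
  assume r: "r \<le> 3"
  have "tame r strip (\<lambda>_. 1) (\<lambda>i p. (1 / 2 ^ snd i) * (2 * (1 - 3/4 * smoothstep 0 (3/2 + 2 * (slow (fst i) (p $ 3) - real (snd i))))))"
    using r by (intro unit_tame_mult unit_tame_inverse_freq unit_tame_diff unit_tame_smoothstep unit_tame_num) auto
  then show ?thesis by (rule tame_cong) (simp add: kapB_def add.commute)
qed

lemma unit_tame_coeff:
  assumes "tame r strip (\<lambda>_. 1) (\<lambda>i p. \<kappa> i (p $ 3))"
  shows "tame r strip (\<lambda>_. 1) (\<lambda>i p. coeff \<mu> (fst i) (snd i + e) (\<kappa> i) (p $ 3))"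
proof -
  have "tame r strip (\<lambda>_. 1) (\<lambda>i p. (rho (slow (fst i) (p $ 3) - real (snd i + e)) * tanh (p $ 3 / fst i))\<^sup>2
     - \<kappa> i (p $ 3) * (1 / fst i) * (rho1 (slow (fst i) (p $ 3) - real (snd i + e)) * (tanh (p $ 3 / fst i))\<^sup>2
       + rho (slow (fst i) (p $ 3) - real (snd i + e)) * (1 - (tanh (p $ 3 / fst i))\<^sup>2)) + \<mu> * (\<kappa> i (p $ 3))\<^sup>2)"
    by (intro tame_add unit_tame_mult unit_tame_diff unit_tame_power2 unit_tame_rho unit_tame_rho1 unit_tame_tanh unit_tame_inverse_L assms
      unit_tame_num)
  then show ?thesis by (rule tame_cong) (simp add: coeff_def)
qed

lemma unit_tame_cutoff: "r \<le> 3 \<Longrightarrow> tame r strip (\<lambda>_. 1) (\<lambda>i p. cutoff c (fst i) (snd i) (p $ 3))"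
  unfolding cutoff_def by (rule unit_tame_smoothstep) simp

lemma unit_tame_cutoff1: "r \<le> 2 \<Longrightarrow> tame r strip (\<lambda>_. 1) (\<lambda>i p. cutoff1 c (fst i) (snd i) (p $ 3))"
proof -
  assume r: "r \<le> 2"
  have "tame r strip (\<lambda>_. 1) (\<lambda>i p. smoothstep (Suc 0) (3 + c * (slow (fst i) (p $ 3) - real (snd i))) * (c * (1 / fst i) * tanh (p $ 3 / fst i)))"
    using r by (intro unit_tame_mult unit_tame_smoothstep unit_tame_tanh unit_tame_inverse_L unit_tame_num) auto
  then show ?thesis by (rule tame_cong) (simp add: cutoff1_def)
qed

text \<open>Two of the three derivatives of the step are spent in \<open>cutoff2\<close>; the one
  that remains is what a C^1 correction consumes.\<close>

lemma unit_tame_cutoff2: "r \<le> 1 \<Longrightarrow> tame r strip (\<lambda>_. 1) (\<lambda>i p. cutoff2 c (fst i) (snd i) (p $ 3))"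
proof -
  assume r: "r \<le> 1"
  have "tame r strip (\<lambda>_. 1) (\<lambda>i p. smoothstep (Suc (Suc 0)) (3 + c * (slow (fst i) (p $ 3) - real (snd i))) * (c * (1 / fst i) * tanh (p $ 3 / fst i))\<^sup>2
     + smoothstep (Suc 0) (3 + c * (slow (fst i) (p $ 3) - real (snd i))) * (c * (1 / fst i) * ((1 - (tanh (p $ 3 / fst i))\<^sup>2) * (1 / fst i))))"
    using r by (intro tame_add unit_tame_mult unit_tame_diff unit_tame_power2 unit_tame_smoothstep unit_tame_tanh unit_tame_inverse_L unit_tame_num) auto
  then show ?thesis by (rule tame_cong) (simp add: cutoff2_def)
qed

lemma cls_const_strip: "(\<And>i. \<bar>c i\<bar> \<le> C * freq i) \<Longrightarrow> cls 0 r strip (\<lambda>i p. c i)"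
  by (rule cls_const[where C = C]) (use strip_open in auto)

lemma cls_freq: "cls 0 r strip (\<lambda>i p. 2 ^ (snd i + e))"
  by (rule cls_const_strip[where C = "2 ^ e"]) (simp add: freq_def power_add)

lemma cls_rate: "cls 0 r strip (\<lambda>i p. rate (fst i) (snd i + e) (p $ 3))"
  unfolding rate_def
  using cls_mult00[OF cls_mult00[OF cls_freq cls_of_bounded[OF unit_tame_rho order_refl]] cls_of_bounded[OF unit_tame_tanh order_refl]] .

text \<open>The tightest case is the incoming mode at the lower end of the strip: 2 * (26/15 - 1 -
  5/8) = 13/60, still above 1/10.\<close>

lemma expo_le_decay:
  assumes "p \<in> strip i" "e \<le> 1"
  shows "expo (fst i) (snd i + e) (p $ 3) \<le> decay i"
proof -
  let ?v = "slow (fst i) (p $ 3) - real (snd i)"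
  have "\<bar>?v\<bar> < 5/8" and L: "1 \<le> fst i" using assms by (simp_all add: strip_def)
  then have v: "- (5/8) < ?v" by linarith
  have "1/10 \<le> 2 ^ e * profile (?v - real e)"
  proof (cases "e = 0")
    case True
    then show ?thesis using profile_lower[of ?v] v unfolding True by simp
  next
    case False
    then have e: "e = 1" using assms by simp
    show ?thesis unfolding e using profile_lower[of "?v - 1"] v by simp
  qed
  then have "fst i * 2 ^ snd i * (1/10) \<le> fst i * 2 ^ snd i * (2 ^ e * profile (?v - real e))"
    using L by (intro mult_left_mono) auto
  then show ?thesis by (simp add: expo_def decay_def power_add algebra_simps)
qed

lemma cls_expo:
  assumes "e \<le> 1"
  shows "cls 1 r strip (\<lambda>i p. expo (fst i) (snd i + e) (p $ 3))"
proof (rule cls_exp_type[where q = "\<lambda>i t. - rate (fst i) (snd i + e) t"])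
  show "(expo (fst i) (snd i + e) has_real_derivative - rate (fst i) (snd i + e) (p $ 3) * expo (fst i) (snd i + e) (p $ 3)) (at (p $ 3))"
    if "p \<in> strip i" for i p
    using that by (intro DERIV_expo) (auto simp: strip_def)
  show "cls 0 r strip (\<lambda>i p. - rate (fst i) (snd i + e) (p $ 3))" for r
    using cls_mult00[OF cls_const_strip[of "\<lambda>_. - 1" 1] cls_rate] freq_ge_1 by simp
  have "continuous_on (strip i) (\<lambda>p. expo (fst i) (snd i + e) (p $ 3))" for i
  proof (cases "strip i = {}")
    case False
    then have "fst i \<noteq> 0" using strip_ne[of i] by auto
    then have "continuous_on UNIV (expo (fst i) (snd i + e))"
      by (intro DERIV_continuous_on[OF DERIV_expo])
    then show ?thesis by (rule continuous_on_compose2) (auto intro!: continuous_intros)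
  qed simp
  moreover have "\<bar>expo (fst i) (snd i + e) (p $ 3)\<bar> \<le> 1 * (freq i ^ 0 * decay i ^ 1)" if "p \<in> strip i" for i p
    using expo_le_decay[OF that assms] by (simp add: expo_def)
  ultimately have "tame 0 strip (\<lambda>i. freq i ^ 0 * decay i ^ 1) (\<lambda>i p. expo (fst i) (snd i + e) (p $ 3))"
    unfolding tame.simps tame0_def using strip_open by blast
  then show "cls 1 0 strip (\<lambda>i p. expo (fst i) (snd i + e) (p $ 3))" unfolding cls_def by blast
qed

lemma cls_amp:
  assumes "e \<le> 1" "r \<le> 3"
  shows "cls 1 r strip (\<lambda>i p. amp c (fst i) (snd i) (snd i + e) (p $ 3))"
  unfolding amp_def by (rule cls_mult01[OF cls_of_bounded[OF unit_tame_cutoff[OF assms(2)] order_refl] cls_expo[OF assms(1)]])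

lemma cls_trig:
  "cls 0 r strip (\<lambda>i p. sin (2 ^ (snd i + e) * p $ l i)) \<and> cls 0 r strip (\<lambda>i p. cos (2 ^ (snd i + e) * p $ l i))"
proof (induction r)
  case 0
  have "tame0 strip (\<lambda>_. 1) (\<lambda>i p. sin (2 ^ (snd i + e) * p $ l i))"
       "tame0 strip (\<lambda>_. 1) (\<lambda>i p. cos (2 ^ (snd i + e) * p $ l i))"
    using strip_open by (auto simp: tame0_def intro!: continuous_intros exI[of _ 1])
  then show ?case by (auto intro!: cls_of_bounded)
next
  case (Suc r)
  have 0: "cls 0 0 strip (\<lambda>i p. sin (2 ^ (snd i + e) * p $ l i))" "cls 0 0 strip (\<lambda>i p. cos (2 ^ (snd i + e) * p $ l i))"
    using Suc cls_antimono by blast+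
  have m: "cls 0 r strip (\<lambda>i p. - (2 ^ (snd i + e)))"
    by (rule cls_const_strip[where C = "2 ^ e"]) (simp add: freq_def power_add)
  have "cls 0 (Suc r) strip (\<lambda>i p. sin (2 ^ (snd i + e) * p $ l i))"
  proof (rule cls_coord[where l = l and f = "\<lambda>i t. sin (2 ^ (snd i + e) * t)" and f' = "\<lambda>i t. 2 ^ (snd i + e) * cos (2 ^ (snd i + e) * t)"])
    show "((\<lambda>t. sin (2 ^ (snd i + e) * t)) has_real_derivative 2 ^ (snd i + e) * cos (2 ^ (snd i + e) * p $ l i)) (at (p $ l i))"
      for i and p :: "real^3" by (auto intro!: derivative_eq_intros)
  qed (use 0 Suc in \<open>auto intro!: cls_mult00 cls_freq\<close>)
  moreover have "cls 0 (Suc r) strip (\<lambda>i p. cos (2 ^ (snd i + e) * p $ l i))"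
  proof (rule cls_coord[where l = l and f = "\<lambda>i t. cos (2 ^ (snd i + e) * t)" and f' = "\<lambda>i t. - (2 ^ (snd i + e)) * sin (2 ^ (snd i + e) * t)"])
    show "((\<lambda>t. cos (2 ^ (snd i + e) * t)) has_real_derivative - (2 ^ (snd i + e)) * sin (2 ^ (snd i + e) * p $ l i)) (at (p $ l i))"
      for i and p :: "real^3" by (auto intro!: derivative_eq_intros)
    show "cls 0 r strip (\<lambda>i p. - (2 ^ (snd i + e)) * sin (2 ^ (snd i + e) * p $ l i))"
      using Suc by (intro cls_mult00 m) auto
  qed (use 0 in auto)
  ultimately show ?case by simp
qed

lemmas cls_sin = cls_trig[THEN conjunct1] and cls_cos = cls_trig[THEN conjunct2]

section \<open>Correction of the switching errors\<close>

text \<open>In strip \<open>n\<close>, \<open>e = 0\<close> stands for the outgoing mode \<open>n\<close> and \<open>e = 1\<close> for the incoming mode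
  \<open>n + 1\<close>; \<open>1 - e\<close> is then the mode that dominates while mode \<open>n + e\<close> is being switched.\<close>
definition side :: "nat \<Rightarrow> real" where "side e = (if e = 0 then - 1 else 1)"

text \<open>The amplitude of the mode being switched divided by that of the dominating mode, as one
  exponential so that its logarithmic derivative is a difference of two rates.
  \<open>err_rel\<close> and \<open>amp1_rel\<close> are likewise measured relative to the
  dominating mode: only such quotients enter the matrix.\<close>

definition ratio :: "nat \<Rightarrow> real \<Rightarrow> nat \<Rightarrow> real \<Rightarrow> real" where
  "ratio e L n t = exp (- (L * (2 ^ (n + e) * profile (slow L t - real (n + e))
     - 2 ^ (n + (1 - e)) * profile (slow L t - real (n + (1 - e))))))"
definition err_rel :: "nat \<Rightarrow> real \<Rightarrow> nat \<Rightarrow> real \<Rightarrow> real" where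
  "err_rel e L n t = (cutoff2 (12 * side e) L n t - 2 * cutoff1 (12 * side e) L n t * rate L (n + e) t) * ratio e L n t"
definition amp1_rel :: "nat \<Rightarrow> real \<Rightarrow> nat \<Rightarrow> real \<Rightarrow> real" where
  "amp1_rel e L n t = (cutoff1 (12 * side e) L n t - cutoff (12 * side e) L n t * rate L (n + e) t) * ratio e L n t
     * (1 / rate L (n + (1 - e)) t)"
text \<open>The switching error of the minor mode is the divergence of a field \<open>V\<close> in its own direction.
  The correction is the row \<open>V * W\<close>, where \<open>W\<close> is the multiple with \<open>W \<bullet> \<nabla>u = 1\<close> of the vector
  \<open>(sin b / k, cos b / f')\<close> (frequency \<open>k\<close>, exponent \<open>f\<close> and phase \<open>b\<close> of the dominating mode).
  \<open>den\<close> is the normalising factor; it is 1 up to the contribution of the minor mode.\<close>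
definition den :: "nat \<Rightarrow> real \<Rightarrow> nat \<Rightarrow> real \<Rightarrow> real \<Rightarrow> real \<Rightarrow> real" where
  "den e L n a b t = 1 - amp1_rel e L n t * (cos (2 ^ (n + e) * a) * cos (2 ^ (n + (1 - e)) * b))"
definition corr_z :: "nat \<Rightarrow> real \<Rightarrow> nat \<Rightarrow> real \<Rightarrow> real \<Rightarrow> real \<Rightarrow> real" where
  "corr_z e L n a b t = err_rel e L n t * (1 / 2 ^ (n + e) * (1 / 2 ^ (n + (1 - e))) *
     (sin (2 ^ (n + e) * a) * sin (2 ^ (n + (1 - e)) * b)) * (1 / den e L n a b t))"
definition corr_t :: "nat \<Rightarrow> real \<Rightarrow> nat \<Rightarrow> real \<Rightarrow> real \<Rightarrow> real \<Rightarrow> real" where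
  "corr_t e L n a b t = err_rel e L n t * (1 / 2 ^ (n + e) * (1 / rate L (n + (1 - e)) t) *
     (sin (2 ^ (n + e) * a) * cos (2 ^ (n + (1 - e)) * b)) * (1 / den e L n a b t))"

text \<open>A neighbourhood of the switching range 1/6 to 1/4; the sign \<open>- side e\<close> lets
  both modes share one description. It overlaps \<open>off\<close>, so that bounds on the two open
  sets combine to bounds on the strip.\<close>

definition zone :: "nat \<Rightarrow> real \<Rightarrow> real \<times> nat \<Rightarrow> (real^3) set" where
  "zone e L1 i = {p \<in> strip i. L1 \<le> fst i \<and> 1/8 < - side e * (slow (fst i) (p $ 3) - real (snd i))
     \<and> - side e * (slow (fst i) (p $ 3) - real (snd i)) < 1/3}"
definition off :: "nat \<Rightarrow> real \<Rightarrow> real \<times> nat \<Rightarrow> (real^3) set" where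
  "off e L1 i = {p \<in> strip i. L1 \<le> fst i \<and> (- side e * (slow (fst i) (p $ 3) - real (snd i)) < 1/6
     \<or> 1/4 < - side e * (slow (fst i) (p $ 3) - real (snd i)))}"
definition big :: "real \<Rightarrow> real \<times> nat \<Rightarrow> (real^3) set" where
  "big L1 i = {p \<in> strip i. L1 \<le> fst i}"

section \<open>Bounds for the corrections in the switching zones\<close>

lemma cont_phase: "continuous_on (strip i) (\<lambda>p. slow (fst i) (p $ 3) - real (snd i))"
  using tame_imp_tame0[OF unit_tame_phase[of 0]] unfolding tame0_def by blast

lemma open_strip_cond:
  assumes "open U"
  shows "open {p \<in> strip i. L1 \<le> fst i \<and> slow (fst i) (p $ 3) - real (snd i) \<in> U}"
proof -
  have "open (strip i \<inter> (\<lambda>p. slow (fst i) (p $ 3) - real (snd i)) -` U)"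
    using continuous_open_preimage[OF cont_phase strip_open assms] .
  then show ?thesis by (cases "L1 \<le> fst i") (auto simp: vimage_def Int_def)
qed

lemma zone_open: "open (zone e L1 i)"
proof -
  have "open {v::real. 1/8 < - side e * v \<and> - side e * v < 1/3}"
    by (intro open_Collect_conj open_Collect_less continuous_intros)
  from open_strip_cond[OF this, of i L1] show ?thesis by (simp add: zone_def)
qed

lemma off_open: "open (off e L1 i)"
proof -
  have "open {v::real. - side e * v < 1/6 \<or> 1/4 < - side e * v}"
    by (intro open_Collect_disj open_Collect_less continuous_intros)
  from open_strip_cond[OF this, of i L1] show ?thesis by (simp add: off_def)
qed

lemma big_open: "open (big L1 i)"
  using open_strip_cond[OF open_UNIV, of i L1] by (simp add: big_def)

lemma zone_subset: "zone e L1 i \<subseteq> strip i" by (auto simp: zone_def)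
lemma off_subset: "off e L1 i \<subseteq> strip i" by (auto simp: off_def)
lemma big_subset: "big L1 i \<subseteq> strip i" by (auto simp: big_def)

lemma big_covered: "big L1 i \<subseteq> zone e L1 i \<union> off e L1 i"
  by (auto simp: big_def zone_def off_def)

lemma ratio_le_decay:
  assumes "p \<in> zone e L1 i" "e \<le> 1"
  shows "ratio e (fst i) (snd i) (p $ 3) \<le> decay i"
proof -
  let ?v = "slow (fst i) (p $ 3) - real (snd i)"
  have z: "1/8 < - side e * ?v" "- side e * ?v < 1/3" "1 \<le> fst i"
    using assms by (auto simp: zone_def strip_def)
  have "1/10 \<le> 2 ^ e * profile (?v - real e) - 2 ^ (1 - e) * profile (?v - real (1 - e))"
  proof (cases "e = 0")
    case True
    then show ?thesis using profile_gap_pos[of ?v] z by (simp add: side_def)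
  next
    case False
    then have "e = 1" using assms by simp
    then show ?thesis using profile_gap_neg[of ?v] z by (simp add: side_def)
  qed
  then have "fst i * 2 ^ snd i * (1/10) \<le> fst i * 2 ^ snd i * (2 ^ e * profile (?v - real e) - 2 ^ (1 - e) * profile (?v - real (1 - e)))"
    using z by (intro mult_left_mono) auto
  then show ?thesis by (simp add: ratio_def decay_def power_add algebra_simps)
qed

text \<open>From n \<ge> 2 and s - n > -1/3 it follows that s > 5/3, so the zone misses t = 0, where
  s = 3/2 and tanh vanishes. Here tanh^2 \<ge> 1 - (6/7)^2 > 1/4.\<close>

lemma rate_lower:
  assumes "p \<in> zone e L1 i" "e \<le> 1"
  shows "1/10 \<le> \<bar>rate (fst i) N (p $ 3)\<bar>"
proof -
  let ?s = "slow (fst i) (p $ 3)" and ?th = "tanh (p $ 3 / fst i)"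
  have "- 1/3 < ?s - real (snd i)" "2 \<le> snd i"
    using assms by (auto simp: zone_def strip_def side_def split: if_splits)
  then have s: "7/6 \<le> 1 + (?s - 3/2)" by linarith
  have "(7/6)\<^sup>2 \<le> (1 + (?s - 3/2))\<^sup>2" by (rule power_mono[OF s]) simp
  then have "1 / (1 + (?s - 3/2))\<^sup>2 \<le> 1 / (7/6)\<^sup>2" using s
    by (intro divide_left_mono mult_pos_pos) auto
  then have "(1/2)\<^sup>2 \<le> ?th\<^sup>2"
    using tanh_sq_slow[of "fst i" "p $ 3"] by (simp add: power2_eq_square)
  then have "1/2 \<le> \<bar>?th\<bar>" unfolding abs_le_square_iff[symmetric] by simp
  then have "1 * (1/5) * (1/2) \<le> 2 ^ N * rho (?s - real N) * \<bar>?th\<bar>"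
    using rho_bounds(1)[of "?s - real N"] by (intro mult_mono) auto
  then show ?thesis
    using rho_bounds(1)[of "?s - real N"] by (simp add: rate_def abs_mult)
qed

lemma DERIV_ratio:
  "L \<noteq> 0 \<Longrightarrow> (ratio e L n has_real_derivative (rate L (n + (1 - e)) t - rate L (n + e) t) * ratio e L n t) (at t)"
proof -
  assume L: "L \<noteq> 0"
  note d = DERIV_cmult[OF DERIV_chain2[OF DERIV_profile DERIV_slow_shift[OF L]]]
  have *: "ratio e L n = (\<lambda>t. exp (- (L * (2 ^ (n + e) * profile (slow L t - real (n + e))
     - 2 ^ (n + (1 - e)) * profile (slow L t - real (n + (1 - e)))))))"
    by (simp add: ratio_def fun_eq_iff)
  have "(ratio e L n has_real_derivative ratio e L n t * - (L * (2 ^ (n + e) * (rho (slow L t - real (n + e)) * (tanh (t / L) / L))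
     - 2 ^ (n + (1 - e)) * (rho (slow L t - real (n + (1 - e))) * (tanh (t / L) / L))))) (at t)"
    unfolding * by (rule DERIV_chain2[OF DERIV_exp DERIV_minus[OF DERIV_cmult[OF DERIV_diff[OF d d]]]])
  moreover have "ratio e L n t * - (L * (2 ^ (n + e) * (rho (slow L t - real (n + e)) * (tanh (t / L) / L))
     - 2 ^ (n + (1 - e)) * (rho (slow L t - real (n + (1 - e))) * (tanh (t / L) / L))))
     = (rate L (n + (1 - e)) t - rate L (n + e) t) * ratio e L n t"
    using L by (simp add: rate_def field_simps)
  ultimately show ?thesis by simp
qed

lemma cls_diff:
  assumes "cls j r S F" "cls j r S G"
  shows "cls j r S (\<lambda>i p. F i p - G i p)"
proof -
  have "cls 0 r S (\<lambda>i p. - 1)"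
  proof (rule cls_const[where C = 1])
    show "\<bar>- 1\<bar> \<le> 1 * freq i" for i using freq_ge_1[of i] by simp
  qed (rule cls_strip[OF assms(1)] cls_open[OF assms(1)])+
  from cls_add[OF assms(1) cls_mult[OF this assms(2), simplified]] show ?thesis by simp
qed

lemma cls_zone: "cls j r strip F \<Longrightarrow> cls j r (zone e L1) F"
  by (erule cls_subset) (rule zone_open zone_subset)+

lemma cls_ratio:
  assumes "e \<le> 1"
  shows "cls 1 r (zone e 1) (\<lambda>i p. ratio e (fst i) (snd i) (p $ 3))"
proof (rule cls_exp_type[where q = "\<lambda>i t. rate (fst i) (snd i + (1 - e)) t - rate (fst i) (snd i + e) t"])
  have nz: "fst i \<noteq> 0" if "p \<in> zone e 1 i" for i p using that by (auto simp: zone_def)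
  show "(ratio e (fst i) (snd i) has_real_derivative (rate (fst i) (snd i + (1 - e)) (p $ 3)
      - rate (fst i) (snd i + e) (p $ 3)) * ratio e (fst i) (snd i) (p $ 3)) (at (p $ 3))"
    if "p \<in> zone e 1 i" for i p
    by (rule DERIV_ratio[OF nz[OF that]])
  show "cls 0 r (zone e 1) (\<lambda>i p. rate (fst i) (snd i + (1 - e)) (p $ 3) - rate (fst i) (snd i + e) (p $ 3))" for r
    by (intro cls_zone cls_diff cls_rate)
  have "continuous_on (zone e 1 i) (\<lambda>p. ratio e (fst i) (snd i) (p $ 3))" for i
  proof (cases "zone e 1 i = {}")
    case False
    then have "fst i \<noteq> 0" using nz by blast
    then have "continuous_on UNIV (ratio e (fst i) (snd i))"
      by (intro DERIV_continuous_on[OF DERIV_ratio])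
    then show ?thesis by (rule continuous_on_compose2) (auto intro!: continuous_intros)
  qed simp
  moreover have "\<bar>ratio e (fst i) (snd i) (p $ 3)\<bar> \<le> 1 * (freq i ^ 0 * decay i ^ 1)" if "p \<in> zone e 1 i" for i p
    using ratio_le_decay[OF that assms] by (simp add: ratio_def)
  ultimately have "tame 0 (zone e 1) (\<lambda>i. freq i ^ 0 * decay i ^ 1) (\<lambda>i p. ratio e (fst i) (snd i) (p $ 3))"
    unfolding tame.simps tame0_def using zone_open by blast
  then show "cls 1 0 (zone e 1) (\<lambda>i p. ratio e (fst i) (snd i) (p $ 3))"
    unfolding cls_def using zone_subset by blast
qed

lemma cls_inverse_rate:
  assumes "e \<le> 1"
  shows "cls 0 r (zone e L1) (\<lambda>i p. 1 / rate (fst i) (snd i + e') (p $ 3))"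
  by (rule cls_inverse[OF cls_zone[OF cls_rate], where c = "1/10"]) (use rate_lower assms in auto)

lemma cls_err_rel:
  assumes "e \<le> 1"
  shows "cls 1 1 (zone e 1) (\<lambda>i p. err_rel e (fst i) (snd i) (p $ 3))"
proof -
  have "cls 0 1 strip (\<lambda>i p. cutoff2 (12 * side e) (fst i) (snd i) (p $ 3)
      - 2 * cutoff1 (12 * side e) (fst i) (snd i) (p $ 3) * rate (fst i) (snd i + e) (p $ 3))"
    by (intro cls_diff cls_mult00 cls_rate cls_of_bounded[OF unit_tame_cutoff1 order_refl]
        cls_of_bounded[OF unit_tame_cutoff2 order_refl] cls_of_bounded[OF unit_tame_num order_refl]) auto
  from cls_mult01[OF cls_zone[OF this] cls_ratio[OF assms]] show ?thesis by (simp add: err_rel_def)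
qed

lemma cls_amp1_rel:
  assumes "e \<le> 1"
  shows "cls 1 1 (zone e 1) (\<lambda>i p. amp1_rel e (fst i) (snd i) (p $ 3))"
proof -
  have "cls 0 1 strip (\<lambda>i p. cutoff1 (12 * side e) (fst i) (snd i) (p $ 3)
      - cutoff (12 * side e) (fst i) (snd i) (p $ 3) * rate (fst i) (snd i + e) (p $ 3))"
    by (intro cls_diff cls_mult00 cls_rate cls_of_bounded[OF unit_tame_cutoff1 order_refl]
        cls_of_bounded[OF unit_tame_cutoff order_refl]) auto
  from cls_mult10[OF cls_mult01[OF cls_zone[OF this] cls_ratio[OF assms]] cls_inverse_rate[OF assms]]
  show ?thesis by (simp add: amp1_rel_def)
qed

text \<open>\<open>amp1_rel\<close> contains a factor \<open>decay\<close>, hence is at most C / L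
  uniformly in n; L \<ge> 2 C brings it below 1/2.\<close>

lemma cls_den:
  assumes "e \<le> 1"
  shows "\<exists>L1\<ge>1. cls 0 1 (zone e L1) (\<lambda>i p. 1 / den e (fst i) (snd i) (p $ l i) (p $ l' i) (p $ 3)) \<and>
    (\<forall>i. \<forall>p\<in>zone e L1 i. \<forall>a b. 1/2 \<le> den e (fst i) (snd i) a b (p $ 3))"
proof -
  obtain C where C: "C > 0" "\<And>i p. p \<in> zone e 1 i \<Longrightarrow> \<bar>amp1_rel e (fst i) (snd i) (p $ 3)\<bar> \<le> C / fst i"
    using cls_1_small[OF cls_amp1_rel[OF assms]] by blast
  define L1 where "L1 = max 1 (2 * C)"
  have sub: "zone e L1 i \<subseteq> zone e 1 i" for i by (auto simp: zone_def L1_def)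
  have ge: "1/2 \<le> den e (fst i) (snd i) a b (p $ 3)" if "p \<in> zone e L1 i" for i p a b
  proof -
    have L: "2 * C \<le> fst i" "1 \<le> fst i" using that by (auto simp: zone_def L1_def)
    let ?m = "amp1_rel e (fst i) (snd i) (p $ 3)" and ?c = "cos (2 ^ (snd i + e) * a) * cos (2 ^ (snd i + (1 - e)) * b)"
    have "\<bar>?m\<bar> \<le> C / fst i" using C(2) sub that by blast
    also have "\<dots> \<le> 1/2" using L by (simp add: field_simps)
    finally have "\<bar>?m\<bar> \<le> 1/2" .
    moreover have "\<bar>?c\<bar> \<le> 1 * 1" unfolding abs_mult by (intro mult_mono) auto
    ultimately have "\<bar>?m\<bar> * \<bar>?c\<bar> \<le> 1/2 * 1" by (intro mult_mono) auto
    then have "\<bar>?m * ?c\<bar> \<le> 1/2" by (simp add: abs_mult)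
    then show ?thesis unfolding den_def by linarith
  qed
  have "cls 0 1 (zone e 1) (\<lambda>i p. 1 - amp1_rel e (fst i) (snd i) (p $ 3) *
      (cos (2 ^ (snd i + e) * p $ l i) * cos (2 ^ (snd i + (1 - e)) * p $ l' i)))"
    by (intro cls_diff cls_mult00 cls_mono[OF cls_amp1_rel[OF assms] le0] cls_zone cls_cos
        cls_of_bounded[OF unit_tame_num order_refl])
  then have "cls 0 1 (zone e L1) (\<lambda>i p. den e (fst i) (snd i) (p $ l i) (p $ l' i) (p $ 3))"
    unfolding den_def by (rule cls_subset) (use sub zone_open in auto)
  then have "cls 0 1 (zone e L1) (\<lambda>i p. 1 / den e (fst i) (snd i) (p $ l i) (p $ l' i) (p $ 3))"
  proof (rule cls_inverse[where c = "1/2"])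
    show "1/2 \<le> \<bar>den e (fst i) (snd i) (p $ l i) (p $ l' i) (p $ 3)\<bar>" if "p \<in> zone e L1 i" for i p
      using ge[OF that, of "p $ l i" "p $ l' i"] by linarith
  qed simp
  then show ?thesis using ge by (intro exI[of _ L1]) (auto simp: L1_def)
qed

lemma err_rel_off:
  assumes "p \<in> off e L1 i" "e \<le> 1"
  shows "err_rel e (fst i) (snd i) (p $ 3) = 0"
proof -
  let ?x = "3 + 12 * side e * (slow (fst i) (p $ 3) - real (snd i))"
  have "?x \<le> 0 \<or> ?x \<ge> 1" using assms by (auto simp: off_def)
  then have "smoothstep (Suc 0) ?x = 0" "smoothstep (Suc (Suc 0)) ?x = 0" by (auto simp: smoothstep_const)
  then show ?thesis by (simp add: err_rel_def cutoff1_def cutoff2_def)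
qed

lemma cls_zero: "(\<And>i. open (S i)) \<Longrightarrow> (\<And>i. S i \<subseteq> strip i) \<Longrightarrow> cls j r S (\<lambda>i p. 0)"
  unfolding cls_def
  by (intro conjI allI exI[of _ 0] tame_const[where C = 0]) (auto simp: decay_pos less_imp_le)

text \<open>The normalising factor is controlled only in the zone, but on \<open>off\<close> the
  factor \<open>err_rel\<close> makes both corrections vanish identically, so the bounds extend to
  the whole strip.\<close>

lemma cls_cor:
  assumes "e \<le> 1"
  shows "\<exists>L1\<ge>1. cls 1 1 (big L1) (\<lambda>i p. corr_z e (fst i) (snd i) (p $ l i) (p $ l' i) (p $ 3)) \<and>
    cls 1 1 (big L1) (\<lambda>i p. corr_t e (fst i) (snd i) (p $ l i) (p $ l' i) (p $ 3)) \<and>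
    (\<forall>i. \<forall>p\<in>zone e L1 i. \<forall>a b. 1/2 \<le> den e (fst i) (snd i) a b (p $ 3))"
proof -
  obtain L1 where L1: "L1 \<ge> 1" "cls 0 1 (zone e L1) (\<lambda>i p. 1 / den e (fst i) (snd i) (p $ l i) (p $ l' i) (p $ 3))"
    "\<forall>i. \<forall>p\<in>zone e L1 i. \<forall>a b. 1/2 \<le> den e (fst i) (snd i) a b (p $ 3)"
    using cls_den[OF assms] by blast
  have inv: "cls 0 1 strip (\<lambda>i p. 1 / 2 ^ (snd i + e'))" for e'
    by (rule cls_of_bounded[OF unit_tame_const[where C = 1]]) auto
  have er: "cls 1 1 (zone e L1) (\<lambda>i p. err_rel e (fst i) (snd i) (p $ 3))"
    by (rule cls_subset[OF cls_err_rel[OF assms]]) (use L1(1) zone_open in \<open>auto simp: zone_def\<close>)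
  have z: "cls 1 1 (zone e L1) (\<lambda>i p. corr_z e (fst i) (snd i) (p $ l i) (p $ l' i) (p $ 3))"
    unfolding corr_z_def
    by (intro cls_mult10[OF er] cls_mult00[OF _ L1(2)] cls_mult00 cls_zone inv cls_sin)
  have t: "cls 1 1 (zone e L1) (\<lambda>i p. corr_t e (fst i) (snd i) (p $ l i) (p $ l' i) (p $ 3))"
    unfolding corr_t_def
    by (intro cls_mult10[OF er] cls_mult00[OF _ L1(2)] cls_mult00[OF _ cls_zone[OF cls_mult00[OF cls_sin cls_cos]]]
       cls_mult00[OF cls_zone[OF inv] cls_inverse_rate[OF assms]])
  have 0: "cls 1 1 (off e L1) (\<lambda>i p. 0)" by (rule cls_zero) (rule off_open off_subset)+
  have "cls 1 1 (off e L1) (\<lambda>i p. corr_z e (fst i) (snd i) (p $ l i) (p $ l' i) (p $ 3))"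
    "cls 1 1 (off e L1) (\<lambda>i p. corr_t e (fst i) (snd i) (p $ l i) (p $ l' i) (p $ 3))"
    by (rule cls_cong[OF 0], simp add: corr_z_def corr_t_def err_rel_off[OF _ assms])+
  then show ?thesis
    using cls_Un[OF z _ big_covered big_open] cls_Un[OF t _ big_covered big_open] L1(1,3) by blast
qed

section \<open>The local solutions\<close>

definition dir :: "nat \<Rightarrow> 3" where "dir n = (if even n then 1 else 2)"

lemma dir_simps: "dir (Suc n) \<noteq> dir n" "dir n \<noteq> dir (Suc n)" "dir n \<noteq> 3" "3 \<noteq> dir n" "dir (Suc (Suc n)) = dir n"
  by (auto simp: dir_def)

lemma UNIV_dir: "(UNIV :: 3 set) = {dir n, dir (Suc n), 3}"
  unfolding UNIV_3 by (auto simp: dir_def)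

lemma sum_dir: "(\<Sum>j\<in>UNIV. f (j :: 3)) = f (dir n) + f (dir (Suc n)) + (f 3 :: real)"
  unfolding UNIV_dir[of n] using dir_simps[of n] dir_simps[of "Suc n"] by (simp add: add.assoc)

definition mode :: "nat \<Rightarrow> real \<Rightarrow> nat \<Rightarrow> real^3 \<Rightarrow> real" where
  "mode e L n p = amp (12 * side e) L n (n + e) (p $ 3) * cos (2 ^ (n + e) * p $ dir (n + e))"
definition uloc :: "real \<Rightarrow> nat \<Rightarrow> real^3 \<Rightarrow> real" where
  "uloc L n p = mode 0 L n p + mode 1 L n p"
definition kap :: "nat \<Rightarrow> real \<Rightarrow> nat \<Rightarrow> real \<Rightarrow> real" where
  "kap e = (if e = 0 then kapA else kapB)"
definition diag :: "real \<Rightarrow> nat \<Rightarrow> real \<Rightarrow> nat \<Rightarrow> real \<Rightarrow> real" where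
  "diag \<mu> e L n t = coeff \<mu> L (n + e) (kap e L n) t"
definition cor_z :: "nat \<Rightarrow> real \<Rightarrow> nat \<Rightarrow> real^3 \<Rightarrow> real" where
  "cor_z e L n p = corr_z e L n (p $ dir (n + e)) (p $ dir (n + (1 - e))) (p $ 3)"
definition cor_t :: "nat \<Rightarrow> real \<Rightarrow> nat \<Rightarrow> real^3 \<Rightarrow> real" where
  "cor_t e L n p = corr_t e L n (p $ dir (n + e)) (p $ dir (n + (1 - e))) (p $ 3)"
text \<open>The third row is a unit vector, so the flux in t is exactly the t-derivative of u. The
  row of \<open>dir n\<close> repairs the outgoing mode and the row of \<open>dir (Suc n)\<close>
  the incoming one; the lack of symmetry lies in these corrections.\<close>

definition Aloc :: "real \<Rightarrow> real \<Rightarrow> nat \<Rightarrow> real^3 \<Rightarrow> real^3^3" where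
  "Aloc \<mu> L n p = (\<chi> r s.
     if r = dir n then (if s = dir n then diag \<mu> 0 L n (p $ 3) else if s = 3 then cor_t 0 L n p else cor_z 0 L n p)
     else if r = 3 then (if s = 3 then 1 else 0)
     else (if s = dir (Suc n) then diag \<mu> 1 L n (p $ 3) else if s = 3 then cor_t 1 L n p else cor_z 1 L n p))"

lemma Aloc_entries:
  "Aloc \<mu> L n p $ dir n $ dir n = diag \<mu> 0 L n (p $ 3)"
  "Aloc \<mu> L n p $ dir n $ dir (Suc n) = cor_z 0 L n p"
  "Aloc \<mu> L n p $ dir n $ 3 = cor_t 0 L n p"
  "Aloc \<mu> L n p $ dir (Suc n) $ dir n = cor_z 1 L n p"
  "Aloc \<mu> L n p $ dir (Suc n) $ dir (Suc n) = diag \<mu> 1 L n (p $ 3)"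
  "Aloc \<mu> L n p $ dir (Suc n) $ 3 = cor_t 1 L n p"
  "Aloc \<mu> L n p $ 3 $ dir n = 0"
  "Aloc \<mu> L n p $ 3 $ dir (Suc n) = 0"
  "Aloc \<mu> L n p $ 3 $ 3 = 1"
  using dir_simps[of n] dir_simps[of "Suc n"] by (simp_all add: Aloc_def)

text \<open>\<open>kapA\<close> stays at 1/2^n up to s - n = 1/4, where the outgoing mode is gone;
  \<open>kapB\<close> has reached 1/2^(n+1) from s - n = -1/4 on, before which the incoming mode is
  absent. The change thus happens in the interval of length 1/2 between the end of mode n and the
  start of mode n + 2.\<close>

lemma kap_cutoff: "cutoff (12 * side e) L n t = 0 \<or> kap e L n t = 1 / 2 ^ (n + e)" if "e \<le> 1"
proof (cases "e = 0")
  case True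
  show ?thesis
  proof (cases "slow L t - real n \<le> 1/4")
    case True
    with \<open>e = 0\<close> show ?thesis by (simp add: kap_def kapA_def smoothstep_const)
  next
    case False
    with \<open>e = 0\<close> show ?thesis by (simp add: cutoff_def side_def smoothstep_const)
  qed
next
  case False
  then have e: "e = 1" using that by simp
  show ?thesis
  proof (cases "slow L t - real n \<ge> - 1/4")
    case True
    with e show ?thesis by (simp add: kap_def kapB_def smoothstep_const)
  next
    case False
    with e show ?thesis by (simp add: cutoff_def side_def smoothstep_const)
  qed
qed

lemma has_partial_mode:
  assumes "L \<noteq> 0"
  shows "has_partial (mode e L n) (dir (n + e)) p
      (- (amp (12 * side e) L n (n + e) (p $ 3) * 2 ^ (n + e) * sin (2 ^ (n + e) * p $ dir (n + e))))"
    "has_partial (mode e L n) 3 p (amp1 (12 * side e) L n (n + e) (p $ 3) * cos (2 ^ (n + e) * p $ dir (n + e)))"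
    "j \<noteq> 3 \<Longrightarrow> j \<noteq> dir (n + e) \<Longrightarrow> has_partial (mode e L n) j p 0"
proof -
  have a: "has_partial (\<lambda>p. amp (12 * side e) L n (n + e) (p $ 3)) k p
      (if k = 3 then amp1 (12 * side e) L n (n + e) (p $ 3) else 0)" for k
    by (rule has_partial_coord[OF DERIV_amp[OF assms]])
  have "((\<lambda>t. cos (2 ^ (n + e) * t)) has_real_derivative - (2 ^ (n + e) * sin (2 ^ (n + e) * p $ dir (n + e)))) (at (p $ dir (n + e)))"
    by (auto intro!: derivative_eq_intros)
  note b = has_partial_coord[OF this]
  note ab = has_partial_mult[OF a b, folded mode_def[abs_def]]
  show "has_partial (mode e L n) (dir (n + e)) p
      (- (amp (12 * side e) L n (n + e) (p $ 3) * 2 ^ (n + e) * sin (2 ^ (n + e) * p $ dir (n + e))))"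
    using ab[of "dir (n + e)"] by (simp add: mode_def[abs_def] dir_simps mult.assoc)
  show "has_partial (mode e L n) 3 p (amp1 (12 * side e) L n (n + e) (p $ 3) * cos (2 ^ (n + e) * p $ dir (n + e)))"
    using ab[of 3] by (simp add: mode_def[abs_def] dir_simps)
  show "j \<noteq> 3 \<Longrightarrow> j \<noteq> dir (n + e) \<Longrightarrow> has_partial (mode e L n) j p 0"
    using ab[of j] by (simp add: mode_def[abs_def])
qed

lemma partial_uloc:
  assumes "L \<noteq> 0" "e \<le> 1"
  shows "partial (uloc L n) (dir (n + e)) p
      = - (amp (12 * side e) L n (n + e) (p $ 3) * 2 ^ (n + e) * sin (2 ^ (n + e) * p $ dir (n + e)))"
    "partial (uloc L n) 3 p = amp1 (12 * side e) L n (n + e) (p $ 3) * cos (2 ^ (n + e) * p $ dir (n + e))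
      + amp1 (12 * side (1 - e)) L n (n + (1 - e)) (p $ 3) * cos (2 ^ (n + (1 - e)) * p $ dir (n + (1 - e)))"
proof -
  have u: "uloc L n = (\<lambda>p. mode e L n p + mode (1 - e) L n p)"
    using assms(2) by (cases "e = 0") (auto simp: uloc_def fun_eq_iff le_Suc_eq)
  have ne: "dir (n + e) \<noteq> 3" "dir (n + e) \<noteq> dir (n + (1 - e))"
    using assms(2) by (auto simp: le_Suc_eq dir_simps)
  show "partial (uloc L n) (dir (n + e)) p
      = - (amp (12 * side e) L n (n + e) (p $ 3) * 2 ^ (n + e) * sin (2 ^ (n + e) * p $ dir (n + e)))"
    unfolding u
    using partial_eq[OF has_partial_add[OF has_partial_mode(1)[OF assms(1)] has_partial_mode(3)[OF assms(1) ne]]]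
    by simp
  show "partial (uloc L n) 3 p = amp1 (12 * side e) L n (n + e) (p $ 3) * cos (2 ^ (n + e) * p $ dir (n + e))
      + amp1 (12 * side (1 - e)) L n (n + (1 - e)) (p $ 3) * cos (2 ^ (n + (1 - e)) * p $ dir (n + (1 - e)))"
    unfolding u
    by (rule partial_eq[OF has_partial_add[OF has_partial_mode(2)[OF assms(1)] has_partial_mode(2)[OF assms(1)]]])
qed

lemma expo_ratio: "expo L (n + e) t = ratio e L n t * expo L (n + (1 - e)) t"
  by (simp add: expo_def ratio_def exp_add[symmetric] algebra_simps)

text \<open>Off the zone both sides vanish. In it the dominating mode contributes sin^2 + cos^2 = 1,
  and the minor mode, which enters only through its t-derivative, turns this 1 into
  \<open>den\<close>.\<close>

lemma flux_correction:
  assumes "p \<in> big L1 (L, n)" "e \<le> 1"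
    and den: "\<forall>i. \<forall>p\<in>zone e L1 i. \<forall>a b. 1/2 \<le> den e (fst i) (snd i) a b (p $ 3)"
  shows "cor_z e L n p * partial (uloc L n) (dir (n + (1 - e))) p + cor_t e L n p * partial (uloc L n) 3 p
    = - (err (12 * side e) L n (n + e) (p $ 3) / 2 ^ (n + e) * sin (2 ^ (n + e) * p $ dir (n + e)))"
proof -
  have L: "L \<noteq> 0" using assms(1) by (auto simp: big_def strip_def)
  let ?t = "p $ 3" and ?N = "n + e" and ?M = "n + (1 - e)"
  let ?a = "p $ dir ?N" and ?b = "p $ dir ?M"
  let ?E = "expo L ?M ?t" and ?er = "err_rel e L n ?t" and ?m = "amp1_rel e L n ?t" and ?rate = "rate L ?M ?t"
  have err: "err (12 * side e) L n ?N ?t = ?er * ?E"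
    by (simp add: err_def err_rel_def expo_ratio[of L n e])
  show ?thesis
  proof (cases "p \<in> off e L1 (L, n)")
    case True
    then have "?er = 0" using err_rel_off[OF True assms(2)] by simp
    then show ?thesis by (simp add: err cor_z_def cor_t_def corr_z_def corr_t_def)
  next
    case False
    then have z: "p \<in> zone e L1 (L, n)" using big_covered assms(1) by blast
    define D where "D = den e L n ?a ?b ?t"
    have D: "D \<noteq> 0" using den[rule_format, OF z, of ?a ?b] unfolding D_def by auto
    have rate: "?rate \<noteq> 0" using rate_lower[OF z assms(2), of ?M] by auto
    have s: "side (1 - e) = - side e" "1 - (1 - e) = e" using assms(2) by (auto simp: side_def le_Suc_eq)
    \<comment> \<open>Before the minor mode starts to be switched the error is 0; from there on the
      cutoff of the dominating mode equals 1, so its gradient is that of the pure mode.\<close>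
    have v: "1/6 \<le> - side e * (slow L ?t - real n)" using False assms(1) by (auto simp: off_def big_def)
    then have x: "3 + 12 * side (1 - e) * (slow L ?t - real n) \<ge> 1" unfolding s by simp
    have M: "amp (12 * side (1 - e)) L n ?M ?t = ?E" "amp1 (12 * side (1 - e)) L n ?M ?t = - (?rate * ?E)"
      using x by (simp_all add: amp_def amp1_def cutoff_def cutoff1_def smoothstep_const)
    have N: "amp1 (12 * side e) L n ?N ?t = ?m * ?rate * ?E"
      using rate by (simp add: amp1_def amp1_rel_def expo_ratio[of L n e])
    have p1: "partial (uloc L n) (dir ?M) p = - (?E * 2 ^ ?M * sin (2 ^ ?M * ?b))"
      using partial_uloc(1)[OF L, of "1 - e" n p] M by simp
    have p2: "partial (uloc L n) 3 p = ?m * ?rate * ?E * cos (2 ^ ?N * ?a) - ?rate * ?E * cos (2 ^ ?M * ?b)"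
      using partial_uloc(2)[OF L assms(2), of n p] M N by simp
    let ?x = "2 ^ ?N * ?a" and ?y = "2 ^ ?M * ?b"
    have D_eq: "D = 1 - ?m * (cos ?x * cos ?y)" by (simp add: D_def den_def)
    have sc: "sin ?y * sin ?y = 1 - cos ?y * cos ?y"
      using sin_cos_squared_add[of ?y] by (simp add: power2_eq_square)
    have "cor_z e L n p * partial (uloc L n) (dir ?M) p + cor_t e L n p * partial (uloc L n) 3 p
      = ?er * ?E * (1 / 2 ^ ?N) * sin ?x * (1 / D) *
        (- (sin ?y * sin ?y) - cos ?y * cos ?y + ?m * (cos ?x * cos ?y))"
    proof -
      have alg: "r * (1 / k * (1 / m) * (sx * sy) * (1 / D)) * - (E * m * sy)
          + r * (1 / k * (1 / f) * (sx * cy) * (1 / D)) * (d * f * E * cx - f * E * cy)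
        = r * E * (1 / k) * sx * (1 / D) * (- (sy * sy) - cy * cy + d * (cx * cy))"
        if "k \<noteq> 0" "m \<noteq> 0" "f \<noteq> 0" for r k m sx sy E f cy d cx :: real
        using that D by (simp add: field_simps)
      show ?thesis
        unfolding cor_z_def cor_t_def corr_z_def corr_t_def D_def[symmetric] p1 p2
        by (rule alg[OF _ _ rate]) simp_all
    qed
    also have "\<dots> = ?er * ?E * (1 / 2 ^ ?N) * sin ?x * (1 / D) * (- D)"
      unfolding sc D_eq by (simp add: algebra_simps)
    also have "\<dots> = - (?er * ?E / 2 ^ ?N * sin ?x)" using D by simp
    finally show ?thesis unfolding err .
  qed
qed

text \<open>On the overlap 3/8 < s - n < 5/8 only mode n + 1 is present, as incoming mode of strip n
  and as outgoing mode of strip n + 1, and no switching takes place. The diagonal entries exchange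
  their roles because \<open>rho\<close> has period 2 and \<open>kapA\<close>, \<open>kapB\<close>
  continue each other.\<close>

lemma uloc_consistent:
  assumes "p \<in> strip (L, n)" "p \<in> strip (L, Suc n)"
  shows "uloc L n p = uloc L (Suc n) p \<and> Aloc \<mu> L n p = Aloc \<mu> L (Suc n) p"
proof -
  let ?v = "slow L (p $ 3) - real n"
  have "\<bar>?v\<bar> < 5/8" "\<bar>slow L (p $ 3) - real (Suc n)\<bar> < 5/8"
    using assms by (simp_all add: strip_def del: of_nat_Suc)
  then have "?v > 3/8" "?v < 5/8" unfolding of_nat_Suc by linarith+
  then have v: "3 - 12 * ?v \<le> 0" "3 + 12 * ?v \<ge> 1" "3 - 12 * (?v - 1) \<ge> 1" "3 + 12 * (?v - 1) \<le> 0"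
    "2 * (?v - 1) - 1/2 \<le> 0" "2 * ?v + 3/2 \<ge> 1" by auto
  have S: "slow L (p $ 3) - real (Suc n) = ?v - 1" by simp
  have c: "cutoff (12 * side 0) L n (p $ 3) = 0" "cutoff (12 * side 1) L n (p $ 3) = 1"
     "cutoff (12 * side 0) L (Suc n) (p $ 3) = 1" "cutoff (12 * side 1) L (Suc n) (p $ 3) = 0"
    unfolding cutoff_def S using v by (auto simp: side_def smoothstep_const simp del: of_nat_Suc)
  have "err_rel e L n (p $ 3) = 0" "err_rel e L (Suc n) (p $ 3) = 0" for e
    unfolding err_rel_def cutoff1_def cutoff2_def S using v by (auto simp: side_def smoothstep_const simp del: of_nat_Suc)
  then have cor: "cor_z e L n p = 0" "cor_t e L n p = 0" "cor_z e L (Suc n) p = 0" "cor_t e L (Suc n) p = 0" for e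
    by (auto simp: cor_z_def cor_t_def corr_z_def corr_t_def)
  have k: "kapA L (Suc n) (p $ 3) = kapB L n (p $ 3)" "kapB L (Suc n) (p $ 3) = kapA L n (p $ 3)"
  proof -
    show "kapA L (Suc n) (p $ 3) = kapB L n (p $ 3)" unfolding kapA_def kapB_def S using v by (simp add: smoothstep_const)
    have "2 * (?v - 1) + 3/2 = 2 * ?v - 1/2" by simp
    moreover have "2 * x / 2 ^ Suc n = x / 2 ^ n" for x :: real by simp
    ultimately show "kapB L (Suc n) (p $ 3) = kapA L n (p $ 3)" unfolding kapA_def kapB_def S by metis
  qed
  have S2: "slow L (p $ 3) - real (Suc (Suc n)) = ?v - 2" by simp
  have a: "diag \<mu> 0 L (Suc n) (p $ 3) = diag \<mu> 1 L n (p $ 3)" "diag \<mu> 1 L (Suc n) (p $ 3) = diag \<mu> 0 L n (p $ 3)"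
    by (simp_all add: diag_def kap_def coeff_def k S2 rho_periodic del: of_nat_Suc)
  show ?thesis
  proof
    show "uloc L n p = uloc L (Suc n) p" using c by (simp add: uloc_def mode_def amp_def)
    show "Aloc \<mu> L n p = Aloc \<mu> L (Suc n) p"
      unfolding vec_eq_iff using UNIV_dir[of n] dir_simps[of n] dir_simps[of "Suc n"]
      by (auto simp: Aloc_def cor a a[unfolded One_nat_def])
  qed
qed

text \<open>Strips of half-width 5/8 can meet only if their indices differ by at most one.\<close>

lemma loc_consistent:
  assumes "p \<in> strip (L, n)" "p \<in> strip (L, m)"
  shows "uloc L n p = uloc L m p \<and> Aloc \<mu> L n p = Aloc \<mu> L m p"
proof -
  have "\<bar>slow L (p $ 3) - real n\<bar> < 5/8" "\<bar>slow L (p $ 3) - real m\<bar> < 5/8"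
    using assms by (simp_all add: strip_def)
  then have "\<bar>real n - real m\<bar> < 5/4" by linarith
  then consider "n = m" | "m = Suc n" | "n = Suc m" by linarith
  then show ?thesis using assms uloc_consistent[of p L] by cases metis+
qed

text \<open>After the correction, the flux in the direction of each mode is a function of t times a
  sine in that direction alone, so its divergence is explicit. It supplies - \<open>err\<close>
  times the cosine, cancelling the error left by \<open>amp_ode\<close>.\<close>

lemma local_pde:
  assumes p: "p \<in> big L1 (L, n)"
    and den: "\<And>e. e \<le> 1 \<Longrightarrow> \<forall>i. \<forall>p\<in>zone e L1 i. \<forall>a b. 1/2 \<le> den e (fst i) (snd i) a b (p $ 3)"
  shows "(\<Sum>i\<in>UNIV. partial (\<lambda>q. \<Sum>j\<in>UNIV. Aloc \<mu> L n q $ i $ j * partial (uloc L n) j q) i p) = - \<mu> * uloc L n p"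
proof -
  have L: "L \<noteq> 0" using p by (auto simp: big_def strip_def)
  let ?J = "\<lambda>i q. \<Sum>j\<in>UNIV. Aloc \<mu> L n q $ i $ j * partial (uloc L n) j q"
  let ?N = "\<lambda>e. n + e"
  let ?f = "\<lambda>e t. - (2 ^ ?N e * diag \<mu> e L n t * amp (12 * side e) L n (?N e) t + err (12 * side e) L n (?N e) t / 2 ^ ?N e)"
  let ?G = "\<lambda>e q. ?f e (q $ 3) * sin (2 ^ ?N e * q $ dir (?N e))"
  have J: "?J (dir (?N e)) q = ?G e q" if q: "q \<in> big L1 (L, n)" and e: "e \<le> 1" for q e
  proof -
    have "?J (dir (?N e)) q = diag \<mu> e L n (q $ 3) * partial (uloc L n) (dir (?N e)) q
       + (cor_z e L n q * partial (uloc L n) (dir (n + (1 - e))) q + cor_t e L n q * partial (uloc L n) 3 q)"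
      using e unfolding sum_dir[of _ n] by (auto simp: le_Suc_eq Aloc_entries)
    then show ?thesis unfolding flux_correction[OF q e den[OF e]] partial_uloc(1)[OF L e]
      by (simp add: algebra_simps)
  qed
  have dJ: "partial (?J (dir (?N e))) (dir (?N e)) p = - ((2 ^ ?N e * 2 ^ ?N e * diag \<mu> e L n (p $ 3) * amp (12 * side e) L n (?N e) (p $ 3)
      + err (12 * side e) L n (?N e) (p $ 3)) * cos (2 ^ ?N e * p $ dir (?N e)))" if e: "e \<le> 1" for e
  proof -
    have 1: "has_partial (\<lambda>q. ?f e (q $ 3)) (dir (?N e)) p 0"
      by (simp add: has_partial_def axis_def dir_simps)
    have "((\<lambda>t. sin (2 ^ ?N e * t)) has_real_derivative (2 ^ ?N e * cos (2 ^ ?N e * p $ dir (?N e)))) (at (p $ dir (?N e)))"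
      by (auto intro!: derivative_eq_intros)
    from has_partial_coord[OF this, of "dir (?N e)"]
    have 2: "has_partial (\<lambda>q. sin (2 ^ ?N e * q $ dir (?N e))) (dir (?N e)) p (2 ^ ?N e * cos (2 ^ ?N e * p $ dir (?N e)))"
      by simp
    have "partial (?J (dir (?N e))) (dir (?N e)) p = partial (?G e) (dir (?N e)) p"
      by (rule partial_cong[OF big_open p J[OF _ e]])
    also have "\<dots> = 0 * sin (2 ^ ?N e * p $ dir (?N e)) + ?f e (p $ 3) * (2 ^ ?N e * cos (2 ^ ?N e * p $ dir (?N e)))"
      by (rule partial_eq[OF has_partial_mult[OF 1 2]])
    also have "\<dots> = - ((2 ^ ?N e * 2 ^ ?N e * diag \<mu> e L n (p $ 3) * amp (12 * side e) L n (?N e) (p $ 3)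
      + err (12 * side e) L n (?N e) (p $ 3)) * cos (2 ^ ?N e * p $ dir (?N e)))"
      by (simp add: field_simps)
    finally show ?thesis .
  qed
  have "?J 3 q = partial (uloc L n) 3 q" for q unfolding sum_dir[of _ n] by (simp add: Aloc_entries)
  then have J3: "?J 3 = (\<lambda>q. amp1 (12 * side 0) L n (?N 0) (q $ 3) * cos (2 ^ ?N 0 * q $ dir (?N 0))
      + amp1 (12 * side 1) L n (?N 1) (q $ 3) * cos (2 ^ ?N 1 * q $ dir (?N 1)))"
    using partial_uloc(2)[OF L, of 0 n] by (simp add: fun_eq_iff)
  have h: "has_partial (\<lambda>q. amp1 (12 * side e) L n (?N e) (q $ 3) * cos (2 ^ ?N e * q $ dir (?N e))) 3 p
      (amp2 (12 * side e) L n (?N e) (p $ 3) * cos (2 ^ ?N e * p $ dir (?N e)))" for e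
  proof -
    have "has_partial (\<lambda>q. cos (2 ^ ?N e * q $ dir (?N e))) 3 p 0"
      using dir_simps(3)[of "?N e"] by (simp add: has_partial_def axis_def)
    moreover have "has_partial (\<lambda>q. amp1 (12 * side e) L n (?N e) (q $ 3)) 3 p
        (if 3 = (3::3) then amp2 (12 * side e) L n (?N e) (p $ 3) else 0)"
      by (rule has_partial_coord[OF DERIV_amp1[OF L]])
    ultimately show ?thesis using has_partial_mult by fastforce
  qed
  have d3: "partial (?J 3) 3 p = amp2 (12 * side 0) L n (?N 0) (p $ 3) * cos (2 ^ ?N 0 * p $ dir (?N 0))
     + amp2 (12 * side 1) L n (?N 1) (p $ 3) * cos (2 ^ ?N 1 * p $ dir (?N 1))"
    unfolding J3 by (rule partial_eq[OF has_partial_add[OF h h]])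
  have ode: "amp2 (12 * side e) L n (?N e) (p $ 3) - 2 ^ ?N e * 2 ^ ?N e * diag \<mu> e L n (p $ 3) * amp (12 * side e) L n (?N e) (p $ 3)
     - err (12 * side e) L n (?N e) (p $ 3) = - \<mu> * amp (12 * side e) L n (?N e) (p $ 3)" if "e \<le> 1" for e
    using amp_ode[where \<mu> = \<mu> and \<kappa> = "kap e L n" and t = "p $ 3", OF kap_cutoff[OF that]] unfolding diag_def by simp
  have "(\<Sum>i\<in>UNIV. partial (?J i) i p) = partial (?J (dir (?N 0))) (dir (?N 0)) p + partial (?J (dir (?N 1))) (dir (?N 1)) p + partial (?J 3) 3 p"
    unfolding sum_dir[where f = "\<lambda>i. partial (?J i) i p" and n = n] by simp
  also have "\<dots> = (amp2 (12 * side 0) L n (?N 0) (p $ 3) - 2 ^ ?N 0 * 2 ^ ?N 0 * diag \<mu> 0 L n (p $ 3) * amp (12 * side 0) L n (?N 0) (p $ 3)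
     - err (12 * side 0) L n (?N 0) (p $ 3)) * cos (2 ^ ?N 0 * p $ dir (?N 0))
     + (amp2 (12 * side 1) L n (?N 1) (p $ 3) - 2 ^ ?N 1 * 2 ^ ?N 1 * diag \<mu> 1 L n (p $ 3) * amp (12 * side 1) L n (?N 1) (p $ 3)
     - err (12 * side 1) L n (?N 1) (p $ 3)) * cos (2 ^ ?N 1 * p $ dir (?N 1))"
    unfolding dJ[OF le0] dJ[OF order_refl] d3 by (simp add: algebra_simps)
  also have "\<dots> = - \<mu> * uloc L n p"
    unfolding ode[OF le0] ode[OF order_refl] by (simp add: uloc_def mode_def algebra_simps)
  finally show ?thesis .
qed

section \<open>The global solution\<close>

text \<open>The condition depends on the index alone; it serves the case distinction on
  \<open>dir n\<close> in \<open>Aloc\<close>.\<close>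

lemma tame_if:
  assumes "tame r S (\<lambda>_. 1) F" "tame r S (\<lambda>_. 1) G"
  shows "tame r S (\<lambda>_. 1) (\<lambda>i p. if P i then F i p else G i p)"
proof -
  have c: "tame r S (\<lambda>_. 1) (\<lambda>i p. if Q i then 1 else 0)" for Q
    by (rule tame_const[where C = 1]) (use tame_open[OF assms(1)] in auto)
  have "tame r S (\<lambda>_. 1) (\<lambda>i p. (if P i then 1 else 0) * F i p + (if \<not> P i then 1 else 0) * G i p)"
    by (intro tame_add unit_tame_mult c assms)
  then show ?thesis by (rule tame_cong) auto
qed

lemma unit_tame_diag: "tame 1 strip (\<lambda>_. 1) (\<lambda>i p. diag \<mu> e (fst i) (snd i) (p $ 3))"
  unfolding diag_def
proof (rule unit_tame_coeff)
  show "tame 1 strip (\<lambda>_. 1) (\<lambda>i p. kap e (fst i) (snd i) (p $ 3))"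
    using unit_tame_kapA[of 1] unit_tame_kapB[of 1] unfolding kap_def by (cases "e = 0") (simp_all del: tame.simps One_nat_def)
qed

lemma unit_tame_strip_big: "tame r strip (\<lambda>_. 1) F \<Longrightarrow> tame r (big L1) (\<lambda>_. 1) F"
  by (erule tame_subset) (rule big_subset big_open)+

text \<open>Allowing all larger \<open>L\<close> and \<open>K\<close> lets the families for e = 0
  and e = 1 share their constants.\<close>

lemma cor_family:
  assumes "e \<le> 1"
  shows "\<exists>L1\<ge>1. \<exists>C>0. \<forall>L\<ge>L1. \<forall>K\<ge>C. tame 1 (big L) (\<lambda>_. 1) (\<lambda>i p. cor_z e (fst i) (snd i) p) \<and>
     tame 1 (big L) (\<lambda>_. 1) (\<lambda>i p. cor_t e (fst i) (snd i) p) \<and>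
     (\<forall>i. \<forall>p\<in>big L i. \<bar>cor_z e (fst i) (snd i) p\<bar> \<le> K / fst i \<and> \<bar>cor_t e (fst i) (snd i) p\<bar> \<le> K / fst i) \<and>
     (\<forall>i. \<forall>p\<in>zone e L i. \<forall>a b. 1/2 \<le> den e (fst i) (snd i) a b (p $ 3))"
proof -
  obtain L1 where L1: "1 \<le> L1" "cls 1 1 (big L1) (\<lambda>i p. cor_z e (fst i) (snd i) p)"
    "cls 1 1 (big L1) (\<lambda>i p. cor_t e (fst i) (snd i) p)"
    "\<forall>i. \<forall>p\<in>zone e L1 i. \<forall>a b. 1/2 \<le> den e (fst i) (snd i) a b (p $ 3)"
    unfolding cor_z_def cor_t_def
    using cls_cor[OF assms, of "\<lambda>i. dir (snd i + e)" "\<lambda>i. dir (snd i + (1 - e))"] by blast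
  obtain C where C: "C > 0" "\<forall>i. \<forall>p\<in>big L1 i. \<bar>cor_z e (fst i) (snd i) p\<bar> \<le> C / fst i"
    using cls_1_small[OF L1(2)] by blast
  obtain D where D: "D > 0" "\<forall>i. \<forall>p\<in>big L1 i. \<bar>cor_t e (fst i) (snd i) p\<bar> \<le> D / fst i"
    using cls_1_small[OF L1(3)] by blast
  have "tame 1 (big L) (\<lambda>_. 1) (\<lambda>i p. cor_z e (fst i) (snd i) p) \<and>
     tame 1 (big L) (\<lambda>_. 1) (\<lambda>i p. cor_t e (fst i) (snd i) p) \<and>
     (\<forall>i. \<forall>p\<in>big L i. \<bar>cor_z e (fst i) (snd i) p\<bar> \<le> K / fst i \<and> \<bar>cor_t e (fst i) (snd i) p\<bar> \<le> K / fst i) \<and>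
     (\<forall>i. \<forall>p\<in>zone e L i. \<forall>a b. 1/2 \<le> den e (fst i) (snd i) a b (p $ 3))"
    if L: "L1 \<le> L" and K: "max C D \<le> K" for L K
  proof (intro conjI allI ballI)
    have sub: "big L i \<subseteq> big L1 i" "zone e L i \<subseteq> zone e L1 i" for i
      using L by (auto simp: big_def zone_def)
    show "tame 1 (big L) (\<lambda>_. 1) (\<lambda>i p. cor_z e (fst i) (snd i) p)"
      by (rule tame_subset[OF cls_1_bounded[OF L1(2)] sub(1) big_open])
    show "tame 1 (big L) (\<lambda>_. 1) (\<lambda>i p. cor_t e (fst i) (snd i) p)"
      by (rule tame_subset[OF cls_1_bounded[OF L1(3)] sub(1) big_open])
    fix i p
    show "1/2 \<le> den e (fst i) (snd i) a b (p $ 3)" if "p \<in> zone e L i" for a b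
      using L1(4) sub(2) that by blast
    assume p: "p \<in> big L i"
    then have "0 \<le> fst i" by (auto simp: big_def strip_def)
    then have "C / fst i \<le> K / fst i" "D / fst i \<le> K / fst i"
      using K by (auto intro: divide_right_mono)
    moreover have "p \<in> big L1 i" using p sub(1) by blast
    ultimately show "\<bar>cor_z e (fst i) (snd i) p\<bar> \<le> K / fst i" "\<bar>cor_t e (fst i) (snd i) p\<bar> \<le> K / fst i"
      using C(2) D(2) by fastforce+
  qed
  moreover have "0 < max C D" using C(1) by simp
  ultimately show ?thesis using L1(1) by blast
qed

text \<open>For n \<ge> 3, s > 19/8 gives tanh^2 \<ge> 1/2, and the squared rate dominates the term
  of order 1/L. The strip n = 2 contains t = 0, where the squared rate vanishes and only \<mu>
  \<kappa>^2 is left: there \<kappa> \<ge> 1/16, and L \<ge> 64 / \<mu> makes it exceed 2 \<kappa> /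
  L by \<mu> / 512.\<close>

lemma diag_lower:
  assumes p: "p \<in> strip (L, n)" and e: "e \<le> 1" and L: "400 \<le> L" "64 / \<mu> \<le> L" and mu: "0 < \<mu>"
  shows "min (1/200) (\<mu> / 512) \<le> diag \<mu> e L n (p $ 3)"
proof -
  let ?s = "slow L (p $ 3)" and ?k = "kap e L n (p $ 3)"
  define \<theta> where "\<theta> = (tanh (p $ 3 / L))\<^sup>2"
  define r where "r = rho (?s - real (n + e))"
  define r1 where "r1 = rho1 (?s - real (n + e))"
  have n: "2 \<le> n" and v: "\<bar>?s - real n\<bar> < 5/8" using p by (simp_all add: strip_def)
  have th: "0 \<le> \<theta>" "\<theta> \<le> 1" using tanh_sq_le by (auto simp: \<theta>_def)
  have r: "1/5 \<le> r" "r \<le> 2" "\<bar>r1\<bar> \<le> 4" unfolding r_def r1_def by (rule rho_bounds)+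
  have k: "0 \<le> ?k" "?k \<le> 1/2" "n = 2 \<Longrightarrow> 1/16 \<le> ?k"
  proof -
    obtain x c where x: "0 \<le> x" "x \<le> 1" "c = 1 \<or> c = 2" "?k = c * (1 - 3/4 * x) / 2 ^ n"
    proof (cases "e = 0")
      case True
      then show ?thesis using that[of "smoothstep 0 (2 * (?s - real n) - 1/2)" 1] smoothstep_0_range
        by (simp add: kap_def kapA_def)
    next
      case False
      then show ?thesis using that[of "smoothstep 0 (2 * (?s - real n) + 3/2)" 2] smoothstep_0_range
        by (simp add: kap_def kapB_def)
    qed
    have "(2::real) ^ 2 \<le> 2 ^ n" using n by (intro power_increasing) auto
    then have n4: "(4::real) \<le> 2 ^ n" by simp
    have c: "1/4 \<le> c * (1 - 3/4 * x)" "c * (1 - 3/4 * x) \<le> 2" using x by auto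
    show "0 \<le> ?k" using c x(4) by simp
    have "c * (1 - 3/4 * x) / 2 ^ n \<le> 2 / 4" using c n4 by (intro frac_le) auto
    then show "?k \<le> 1/2" using x(4) by simp
    show "1/16 \<le> ?k" if "n = 2" using c x(4) that by simp
  qed
  have diag: "diag \<mu> e L n (p $ 3) = r\<^sup>2 * \<theta> - ?k / L * (r1 * \<theta> + r * (1 - \<theta>)) + \<mu> * ?k\<^sup>2"
    by (simp add: diag_def coeff_def \<theta>_def r_def r1_def power_mult_distrib)
  have "(1/5)\<^sup>2 \<le> r\<^sup>2" using r(1) by (intro power_mono) auto
  then have 1: "1/25 * \<theta> \<le> r\<^sup>2 * \<theta>" using th by (intro mult_right_mono) (auto simp: power2_eq_square)
  have 2: "r1 * \<theta> + r * (1 - \<theta>) \<le> 4 * \<theta> + 2"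
  proof -
    have "r1 * \<theta> \<le> 4 * \<theta>" using r(3) th by (intro mult_right_mono) auto
    moreover have "r * (1 - \<theta>) \<le> 2 * 1" using r th by (intro mult_mono) auto
    ultimately show ?thesis by simp
  qed
  have kL: "0 \<le> ?k / L" using k L by simp
  have 3: "?k / L * (r1 * \<theta> + r * (1 - \<theta>)) \<le> ?k / L * (4 * \<theta> + 2)"
    by (rule mult_left_mono[OF 2 kL])
  have kL2: "?k / L \<le> (1/2) / 400" using k L by (intro frac_le) auto
  have 4: "?k / L * (4 * \<theta>) \<le> (1/2) / 400 * (4 * \<theta>)" using kL2 th by (intro mult_right_mono) auto
  have 5: "?k / L * (4 * \<theta> + 2) = ?k / L * (4 * \<theta>) + 2 * (?k / L)"
    by (simp add: algebra_simps add_divide_distrib)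
  have low: "\<theta> / 50 + (\<mu> * ?k\<^sup>2 - 2 * (?k / L)) \<le> diag \<mu> e L n (p $ 3)"
    using 1 3 4 th unfolding diag 5 by linarith
  show ?thesis
  proof (cases "n = 2")
    case True
    have "2 / L \<le> \<mu> / 32" using L mu by (simp add: field_simps)
    moreover have "\<mu> * (1/16) \<le> \<mu> * ?k" using k(3)[OF True] mu by (intro mult_left_mono) auto
    ultimately have *: "\<mu> / 32 \<le> \<mu> * ?k - 2 / L" by linarith
    have "1/16 * (\<mu> / 32) \<le> ?k * (\<mu> * ?k - 2 / L)"
      using k(3)[OF True] * mu by (intro mult_mono) auto
    then have "\<mu> / 512 \<le> \<mu> * ?k\<^sup>2 - 2 * (?k / L)" by (simp add: power2_eq_square algebra_simps)
    then show ?thesis using low th by linarith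
  next
    case False
    then have "3 \<le> real n" using n by linarith
    then have s: "15/8 \<le> 1 + (?s - 3/2)" using v by linarith
    have "(15/8)\<^sup>2 \<le> (1 + (?s - 3/2))\<^sup>2" by (rule power_mono[OF s]) simp
    then have "1 / (1 + (?s - 3/2))\<^sup>2 \<le> 1 / (15/8)\<^sup>2" using s
      by (intro divide_left_mono mult_pos_pos) auto
    then have "1/2 \<le> \<theta>" using tanh_sq_slow[of L "p $ 3"] unfolding \<theta>_def by (simp add: power2_eq_square)
    moreover have "0 \<le> \<mu> * ?k\<^sup>2" using mu by simp
    ultimately show ?thesis using low kL2 by linarith
  qed
qed

text \<open>Each mixed product is split by 2 |u v| \<le> u^2 + v^2. No variable occurs in more than
  three of the four products, so they cost at most 3/2 d, hence 2 d, per square.\<close>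

lemma quadratic_form_bounds:
  fixes x y z :: real
  assumes "\<bar>c1\<bar> \<le> d" "\<bar>c2\<bar> \<le> d" "\<bar>c3\<bar> \<le> d" "\<bar>c4\<bar> \<le> d"
    "m \<le> a1" "m \<le> a2" "m \<le> 1" "a1 \<le> K" "a2 \<le> K" "1 \<le> K"
  defines "Q \<equiv> x * (a1 * x + c1 * y + c2 * z) + y * (c3 * x + a2 * y + c4 * z) + z * z"
    and "N \<equiv> x\<^sup>2 + y\<^sup>2 + z\<^sup>2"
  shows "(m - 2 * d) * N \<le> Q" "Q \<le> (K + 2 * d) * N"
proof -
  have d: "0 \<le> d" using assms(1) by linarith
  have pr: "\<bar>c * (u * v)\<bar> \<le> d * (u\<^sup>2 + v\<^sup>2) / 2" if "\<bar>c\<bar> \<le> d" for c u v :: real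
  proof -
    have "2 * (\<bar>u\<bar> * \<bar>v\<bar>) \<le> u\<^sup>2 + v\<^sup>2"
      using sum_squares_bound[of "\<bar>u\<bar>" "\<bar>v\<bar>"] by simp
    then have "\<bar>u * v\<bar> \<le> (u\<^sup>2 + v\<^sup>2) / 2" by (simp add: abs_mult)
    then have "\<bar>c\<bar> * \<bar>u * v\<bar> \<le> d * ((u\<^sup>2 + v\<^sup>2) / 2)" using that d by (intro mult_mono) auto
    then show ?thesis by (simp add: abs_mult)
  qed
  define R where "R = c1 * (x * y) + c2 * (x * z) + c3 * (y * x) + c4 * (y * z)"
  have "\<bar>R\<bar> \<le> d * (x\<^sup>2 + y\<^sup>2) / 2 + d * (x\<^sup>2 + z\<^sup>2) / 2 + d * (y\<^sup>2 + x\<^sup>2) / 2 + d * (y\<^sup>2 + z\<^sup>2) / 2"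
    using pr[OF assms(1), of x y] pr[OF assms(2), of x z] pr[OF assms(3), of y x] pr[OF assms(4), of y z]
    unfolding R_def by linarith
  also have "\<dots> \<le> 2 * d * N"
    using d by (simp add: N_def field_simps)
  finally have R: "\<bar>R\<bar> \<le> 2 * d * N" .
  have Q: "Q = a1 * x\<^sup>2 + a2 * y\<^sup>2 + 1 * z\<^sup>2 + R"
    by (simp add: Q_def R_def power2_eq_square algebra_simps)
  have "m * x\<^sup>2 \<le> a1 * x\<^sup>2" "m * y\<^sup>2 \<le> a2 * y\<^sup>2" "m * z\<^sup>2 \<le> 1 * z\<^sup>2"
    "a1 * x\<^sup>2 \<le> K * x\<^sup>2" "a2 * y\<^sup>2 \<le> K * y\<^sup>2" "1 * z\<^sup>2 \<le> K * z\<^sup>2"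
    by (rule mult_right_mono[OF _ zero_le_power2], fact)+
  then have "m * N \<le> Q - R" "Q - R \<le> K * N" unfolding Q N_def by (simp_all add: algebra_simps)
  then show "(m - 2 * d) * N \<le> Q" "Q \<le> (K + 2 * d) * N"
    using R by (simp_all add: algebra_simps)
qed

lemma Aloc_quadratic:
  "\<xi> \<bullet> (Aloc \<mu> L n p *v \<xi>) =
     \<xi> $ dir n * (diag \<mu> 0 L n (p $ 3) * \<xi> $ dir n + cor_z 0 L n p * \<xi> $ dir (Suc n) + cor_t 0 L n p * \<xi> $ 3)
   + \<xi> $ dir (Suc n) * (cor_z 1 L n p * \<xi> $ dir n + diag \<mu> 1 L n (p $ 3) * \<xi> $ dir (Suc n) + cor_t 1 L n p * \<xi> $ 3)
   + \<xi> $ 3 * \<xi> $ 3"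
  unfolding inner_vec_def matrix_vector_mult_def sum_dir[of _ n] by (simp add: Aloc_entries sum_dir[of _ n])

lemma norm_dir: "norm (\<xi> :: real^3) ^ 2 = (\<xi> $ dir n)\<^sup>2 + (\<xi> $ dir (Suc n))\<^sup>2 + (\<xi> $ 3)\<^sup>2"
  unfolding power2_norm_eq_inner inner_vec_def sum_dir[of _ n] by (simp add: power2_eq_square)

section \<open>From the strips to the whole space: choice of strip, periodicity, decay\<close>

definition strip_index :: "real \<Rightarrow> real^3 \<Rightarrow> nat" where
  "strip_index L p = nat \<lfloor>slow L (p $ 3) + 1/2\<rfloor>"

lemma strip_index_strip: "1 \<le> L \<Longrightarrow> p \<in> strip (L, strip_index L p)"
proof -
  assume L: "1 \<le> L"
  have s: "3/2 \<le> slow L (p $ 3)" by (rule slow_ge)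
  then have i: "2 \<le> \<lfloor>slow L (p $ 3) + 1/2\<rfloor>" by (simp add: le_floor_iff)
  then have r: "real (strip_index L p) = real_of_int \<lfloor>slow L (p $ 3) + 1/2\<rfloor>" by (simp add: strip_index_def)
  have "\<bar>slow L (p $ 3) - real (strip_index L p)\<bar> < 5/8" unfolding r by linarith
  moreover have "2 \<le> strip_index L p" using nat_mono[OF i] unfolding strip_index_def nat_numeral .
  ultimately show ?thesis using L by (simp add: strip_def)
qed

lemma trig_periodic:
  "sin (2 ^ N * ((p + (2 * pi) *\<^sub>R axis k 1) :: real^3) $ l) = sin (2 ^ N * p $ l)"
  "cos (2 ^ N * ((p + (2 * pi) *\<^sub>R axis k 1) :: real^3) $ l) = cos (2 ^ N * p $ l)"
proof -
  have c: "cos (2 * pi * 2 ^ N) = 1" "sin (2 * pi * 2 ^ N) = 0"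
    using cos_integer_2pi[of "2 ^ N"] sin_integer_2pi[of "2 ^ N"] by auto
  have a: "2 ^ N * ((p + (2 * pi) *\<^sub>R axis k 1)) $ l = 2 ^ N * p $ l + (if l = k then 2 * pi * 2 ^ N else 0)"
    by (simp add: axis_def algebra_simps)
  show "sin (2 ^ N * ((p + (2 * pi) *\<^sub>R axis k 1) :: real^3) $ l) = sin (2 ^ N * p $ l)"
    "cos (2 ^ N * ((p + (2 * pi) *\<^sub>R axis k 1) :: real^3) $ l) = cos (2 ^ N * p $ l)"
    unfolding a using c by (simp_all add: sin_add cos_add)
qed

lemma loc_periodic:
  assumes "k \<noteq> 3"
  defines "q \<equiv> \<lambda>p :: real^3. p + (2 * pi) *\<^sub>R axis k 1"
  shows "uloc L n (q p) = uloc L n p" "Aloc \<mu> L n (q p) = Aloc \<mu> L n p" "strip_index L (q p) = strip_index L p"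
proof -
  have 3: "q p $ 3 = p $ 3" using assms(1) by (simp add: q_def axis_def)
  have tr: "sin (2 ^ N * q p $ l) = sin (2 ^ N * p $ l)" "cos (2 ^ N * q p $ l) = cos (2 ^ N * p $ l)" for N l
    unfolding q_def by (rule trig_periodic)+
  show "uloc L n (q p) = uloc L n p" by (simp only: uloc_def mode_def 3 tr)
  show "strip_index L (q p) = strip_index L p" by (simp only: strip_index_def 3)
  show "Aloc \<mu> L n (q p) = Aloc \<mu> L n p"
    by (simp only: Aloc_def cor_z_def cor_t_def corr_z_def corr_t_def den_def 3 tr)
qed

lemma uloc_le:
  assumes "p \<in> strip (L, n)"
  shows "\<bar>uloc L n p\<bar> \<le> 2 * decay (L, n)"
proof -
  have "\<bar>mode e L n p\<bar> \<le> decay (L, n)" if "e \<le> 1" for e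
  proof -
    have "\<bar>cutoff (12 * side e) L n (p $ 3)\<bar> \<le> 1" using smoothstep_0_range by (simp add: cutoff_def)
    moreover have "\<bar>expo L (n + e) (p $ 3)\<bar> \<le> decay (L, n)"
      using expo_le_decay[OF assms that] by (simp add: expo_def)
    ultimately have "\<bar>cutoff (12 * side e) L n (p $ 3)\<bar> * \<bar>expo L (n + e) (p $ 3)\<bar> * \<bar>cos (2 ^ (n + e) * p $ dir (n + e))\<bar>
        \<le> 1 * decay (L, n) * 1"
      using decay_pos[of "(L, n)"] by (intro mult_mono) auto
    then show ?thesis by (simp add: mode_def amp_def abs_mult)
  qed
  from this[of 0] this[of 1] show ?thesis unfolding uloc_def by simp
qed

lemma strip_index_lower:
  assumes "1 \<le> L"
  shows "\<bar>p $ 3\<bar> / L - 1 \<le> real (strip_index L p)"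
proof -
  let ?x = "p $ 3 / L"
  have "exp \<bar>?x\<bar> / 2 \<le> cosh ?x" by (simp add: cosh_def abs_if)
  then have "ln (exp \<bar>?x\<bar> / 2) \<le> ln (cosh ?x)" by (subst ln_le_cancel_iff) (auto simp: cosh_real_pos)
  then have "\<bar>?x\<bar> - ln 2 \<le> ln (cosh ?x)" by (simp add: ln_div)
  then have "\<bar>?x\<bar> + 1/2 \<le> slow L (p $ 3)" using ln_2_less_1 by (simp add: slow_def)
  moreover have "\<bar>slow L (p $ 3) - real (strip_index L p)\<bar> < 5/8"
    using strip_index_strip[OF assms, of p] by (simp add: strip_def)
  moreover have "\<bar>?x\<bar> = \<bar>p $ 3\<bar> / L" using assms by (simp add: abs_divide)
  ultimately show ?thesis by linarith
qed

text \<open>The bound is 2 exp (- L 2^n / 10) with n \<ge> T/L - 1. The loss of 1 in n halves L / 10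
  to L / 20, and 2^(T/L) has rate ln 2 / L; the minimum serves both places where \<open>c\<close>
  occurs.\<close>

lemma u_decay:
  assumes "1 \<le> L" "0 \<le> T" "T \<le> \<bar>p $ 3\<bar>"
  defines "c \<equiv> min (L / 20) (ln 2 / L)"
  shows "\<bar>uloc L (strip_index L p) p\<bar> \<le> 2 * exp (- c * exp (c * T))"
proof -
  let ?n = "strip_index L p"
  have c: "c \<le> L / 20" "c \<le> ln 2 / L" unfolding c_def by (rule min.cobounded1 min.cobounded2)+
  have "0 < c" using assms(1) by (simp add: c_def)
  note c = c this
  have "T / L - 1 \<le> real ?n"
    using strip_index_lower[OF assms(1), of p] divide_right_mono[OF assms(3), of L] assms(1) by linarith
  then have "(T / L - 1) * ln 2 \<le> real ?n * ln 2" by (intro mult_right_mono) auto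
  then have "exp ((T / L - 1) * ln 2) \<le> exp (real ?n * ln 2)" by simp
  also have "\<dots> = 2 ^ ?n" by (simp add: exp_of_nat_mult)
  finally have "exp (ln 2 / L * T) / 2 \<le> 2 ^ ?n"
  proof -
    assume "exp ((T / L - 1) * ln 2) \<le> 2 ^ ?n"
    moreover have "(T / L - 1) * ln 2 = ln 2 / L * T - ln 2" by (simp add: algebra_simps)
    ultimately show ?thesis by (simp only: exp_diff) simp
  qed
  moreover have "exp (c * T) \<le> exp (ln 2 / L * T)"
    using c assms(2) by (simp add: mult_right_mono del: times_divide_eq_left)
  ultimately have "exp (c * T) / 2 \<le> 2 ^ ?n" by linarith
  then have "c * exp (c * T) \<le> L / 20 * (2 * 2 ^ ?n)"
    using c by (intro mult_mono) auto
  then have "decay (L, ?n) \<le> exp (- c * exp (c * T))" by (simp add: decay_def)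
  then show ?thesis using uloc_le[OF strip_index_strip[OF assms(1), of p]] by linarith
qed

lemma cls_mode: "e \<le> 1 \<Longrightarrow> cls 1 2 strip (\<lambda>i p. mode e (fst i) (snd i) p)"
  unfolding mode_def by (intro cls_mult10 cls_amp cls_cos) auto

theorem theorem1p2:
  fixes \<mu> :: real
  assumes "\<mu> > 0"
  shows "\<exists>(A :: real^3 \<Rightarrow> real^3^3) (u :: real^3 \<Rightarrow> real).
     periodic_xy A \<and> unif_elliptic A \<and> (\<forall>i j. unif_C1 (\<lambda>p. A p $ i $ j)) \<and>
     periodic_xy u \<and> unif_C2 u \<and> (\<exists>p. u p \<noteq> 0) \<and>
     (\<forall>p. div_A_grad A u p = - \<mu> * u p) \<and>
     (\<exists>c C T0. c > 0 \<and> C > 0 \<and>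
        (\<forall>T \<ge> T0. \<forall>p. \<bar>p $ 3\<bar> \<ge> T \<longrightarrow> \<bar>u p\<bar> \<le> C * exp (- c * exp (c * T))))"
proof -
  obtain La Ca where La: "1 \<le> La" "0 < Ca" and a: "\<And>L K. La \<le> L \<Longrightarrow> Ca \<le> K \<Longrightarrow>
     tame 1 (big L) (\<lambda>_. 1) (\<lambda>i p. cor_z 0 (fst i) (snd i) p) \<and>
     tame 1 (big L) (\<lambda>_. 1) (\<lambda>i p. cor_t 0 (fst i) (snd i) p) \<and>
     (\<forall>i. \<forall>p\<in>big L i. \<bar>cor_z 0 (fst i) (snd i) p\<bar> \<le> K / fst i \<and> \<bar>cor_t 0 (fst i) (snd i) p\<bar> \<le> K / fst i) \<and>
     (\<forall>i. \<forall>p\<in>zone 0 L i. \<forall>a b. 1/2 \<le> den 0 (fst i) (snd i) a b (p $ 3))"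
    using cor_family[OF le0] by blast
  obtain Lb Cb where Lb: "1 \<le> Lb" "0 < Cb" and b: "\<And>L K. Lb \<le> L \<Longrightarrow> Cb \<le> K \<Longrightarrow>
     tame 1 (big L) (\<lambda>_. 1) (\<lambda>i p. cor_z 1 (fst i) (snd i) p) \<and>
     tame 1 (big L) (\<lambda>_. 1) (\<lambda>i p. cor_t 1 (fst i) (snd i) p) \<and>
     (\<forall>i. \<forall>p\<in>big L i. \<bar>cor_z 1 (fst i) (snd i) p\<bar> \<le> K / fst i \<and> \<bar>cor_t 1 (fst i) (snd i) p\<bar> \<le> K / fst i) \<and>
     (\<forall>i. \<forall>p\<in>zone 1 L i. \<forall>a b. 1/2 \<le> den 1 (fst i) (snd i) a b (p $ 3))"
    using cor_family[OF order_refl] by blast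
  define L1 where "L1 = max La Lb"
  define C where "C = max Ca Cb"
  have L1: "1 \<le> L1" and C: "0 < C" using La by (auto simp: L1_def C_def)
  note a = a[of L1 C, unfolded L1_def C_def, OF max.cobounded1 max.cobounded1, folded L1_def C_def]
  note b = b[of L1 C, unfolded L1_def C_def, OF max.cobounded2 max.cobounded2, folded L1_def C_def]
  have den: "\<forall>i. \<forall>p\<in>zone e L1 i. \<forall>a b. 1/2 \<le> den e (fst i) (snd i) a b (p $ 3)" if "e \<le> 1" for e
    using that a b by (cases "e = 0") (auto simp: le_Suc_eq)
  note fam = a[THEN conjunct1] a[THEN conjunct2, THEN conjunct1] b[THEN conjunct1] b[THEN conjunct2, THEN conjunct1]
  note small = a[THEN conjunct2, THEN conjunct2, THEN conjunct1, rule_format]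
    b[THEN conjunct2, THEN conjunct2, THEN conjunct1, rule_format]
  define m where "m = min (1/200) (\<mu> / 512)"
  have m: "0 < m" "m \<le> 1" using assms by (auto simp: m_def)
  \<comment> \<open>\<open>L1\<close> controls the normalising factors, 400 and 64 / \<mu> are the
    thresholds of \<open>diag_lower\<close>, and 4 C / m makes the off-diagonal entries cost at most
    half of the diagonal bound \<open>m\<close>. None of \<open>L1\<close>, \<open>C\<close>,
    \<open>m\<close> depends on \<open>L\<close>.\<close>
  define L where "L = max (max L1 400) (max (64 / \<mu>) (4 * C / m))"
  have L: "L1 \<le> L" "400 \<le> L" "64 / \<mu> \<le> L" "4 * C / m \<le> L" by (auto simp: L_def)
  define d where "d = C / L"
  have d: "0 \<le> d" "2 * d \<le> m / 2"
    using L(2,4) C m by (auto simp: d_def field_simps)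
  define A where "A p = Aloc \<mu> L (strip_index L p) p" for p
  define u where "u p = uloc L (strip_index L p) p" for p
  have in_big: "p \<in> big L1 (L, strip_index L p)" for p
    using strip_index_strip[of L p] L by (auto simp: big_def)
  \<comment> \<open>Not only the nearest strip but every strip containing the point represents
    \<open>u\<close> and \<open>A\<close>; this gives agreement on open sets and hence equality of
    derivatives.\<close>
  have loc: "u p = uloc L n p" "A p = Aloc \<mu> L n p" if "p \<in> big L1 (L, n)" for p n
    using loc_consistent[of p L "strip_index L p" n \<mu>] strip_index_strip[of L p] L that by (auto simp: big_def A_def u_def)
  have cover: "(\<Union>i\<in>{L} \<times> UNIV. big L1 i) = UNIV" using in_big by blast

  have "periodic_xy A" "periodic_xy u"
    unfolding periodic_xy_def A_def u_def by (simp_all add: loc_periodic)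
  moreover have "unif_C1 (\<lambda>p. A p $ r $ s)" for r s
  proof (rule unif_C1_glue[OF _ cover])
    have b: "tame 1 (big L1) (\<lambda>_. 1) (\<lambda>i p. c)" for c
      by (rule unit_tame_strip_big[OF unit_tame_num])
    show "tame (Suc 0) (big L1) (\<lambda>_. 1) (\<lambda>i p. Aloc \<mu> (fst i) (snd i) p $ r $ s)"
      unfolding Aloc_def vec_lambda_beta One_nat_def[symmetric]
      by (intro tame_if unit_tame_strip_big[OF unit_tame_diag] fam b le0 order_refl)
    show "A p $ r $ s = Aloc \<mu> (fst i) (snd i) p $ r $ s" if "i \<in> {L} \<times> UNIV" "p \<in> big L1 i" for i p
      using loc(2)[of p "snd i"] that by auto
  qed
  moreover have "unif_C2 u"
  proof (rule unif_C2_glue[OF _ cover])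
    have "tame 2 strip (\<lambda>_. 1) (\<lambda>i p. uloc (fst i) (snd i) p)"
      unfolding uloc_def by (intro tame_add cls_1_bounded cls_mode) auto
    then show "tame (Suc (Suc 0)) (big L1) (\<lambda>_. 1) (\<lambda>i p. uloc (fst i) (snd i) p)"
      unfolding numeral_2_eq_2 by (rule unit_tame_strip_big)
    show "u p = uloc (fst i) (snd i) p" if "i \<in> {L} \<times> UNIV" "p \<in> big L1 i" for i p
      using loc(1)[of p "snd i"] that by auto
  qed
  moreover have "unif_elliptic A"
  proof -
    obtain K0 where K0: "\<forall>i. \<forall>p\<in>strip i. \<bar>diag \<mu> 0 (fst i) (snd i) (p $ 3)\<bar> \<le> K0 * 1"
      using tame_imp_tame0[OF unit_tame_diag[of \<mu> 0]] unfolding tame0_def by blast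
    obtain K1 where K1: "\<forall>i. \<forall>p\<in>strip i. \<bar>diag \<mu> 1 (fst i) (snd i) (p $ 3)\<bar> \<le> K1 * 1"
      using tame_imp_tame0[OF unit_tame_diag[of \<mu> 1]] unfolding tame0_def by blast
    define K where "K = max 1 (max K0 K1)"
    define \<Lambda> where "\<Lambda> = max (2 / m) (K + 2 * d)"
    have La: "1 \<le> \<Lambda>" "2 / m \<le> \<Lambda>" "K + 2 * d \<le> \<Lambda>" using d(1) by (auto simp: \<Lambda>_def K_def)
    have "norm \<xi> ^ 2 / \<Lambda> \<le> \<xi> \<bullet> (A p *v \<xi>) \<and> \<xi> \<bullet> (A p *v \<xi>) \<le> \<Lambda> * norm \<xi> ^ 2" for p \<xi>
    proof -
      let ?n = "strip_index L p"
      have st: "p \<in> strip (L, ?n)" using strip_index_strip[of L p] L by simp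
      have up: "diag \<mu> 0 L ?n (p $ 3) \<le> K" "diag \<mu> 1 L ?n (p $ 3) \<le> K" "1 \<le> K"
        using K0[rule_format, OF st] K1[rule_format, OF st] by (auto simp: K_def)
      note sm = small(1)[OF in_big[of p], unfolded fst_conv snd_conv, folded d_def]
        small(2)[OF in_big[of p], unfolded fst_conv snd_conv, folded d_def]
      note lw = diag_lower[OF st le0 L(2,3) assms, folded m_def] diag_lower[OF st order_refl L(2,3) assms, folded m_def]
      note q = quadratic_form_bounds[OF sm(1)[THEN conjunct1] sm(1)[THEN conjunct2] sm(2)[THEN conjunct1]
          sm(2)[THEN conjunct2] lw m(2) up, where x = "\<xi> $ dir ?n" and y = "\<xi> $ dir (Suc ?n)" and z = "\<xi> $ 3",
          folded Aloc_quadratic norm_dir, folded A_def]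
      have "norm \<xi> ^ 2 / \<Lambda> \<le> norm \<xi> ^ 2 / (2 / m)"
        using La m by (intro divide_left_mono mult_pos_pos) auto
      also have "\<dots> = m / 2 * norm \<xi> ^ 2" by simp
      also have "\<dots> \<le> (m - 2 * d) * norm \<xi> ^ 2" using d by (intro mult_right_mono) auto
      finally have "norm \<xi> ^ 2 / \<Lambda> \<le> \<xi> \<bullet> (A p *v \<xi>)" using q(1) by linarith
      moreover have "(K + 2 * d) * norm \<xi> ^ 2 \<le> \<Lambda> * norm \<xi> ^ 2" using La by (intro mult_right_mono) auto
      ultimately show ?thesis using q(2) by linarith
    qed
    then show ?thesis unfolding unif_elliptic_def using La(1) by blast
  qed
  moreover have "div_A_grad A u p = - \<mu> * u p" for p
  proof -
    let ?n = "strip_index L p" and ?B = "big L1 (L, strip_index L p)"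
    have pu: "partial u j q = partial (uloc L ?n) j q" if "q \<in> ?B" for j q
      by (rule partial_cong[OF big_open that loc(1)])
    have "partial (\<lambda>q. \<Sum>j\<in>UNIV. A q $ i $ j * partial u j q) i p
        = partial (\<lambda>q. \<Sum>j\<in>UNIV. Aloc \<mu> L ?n q $ i $ j * partial (uloc L ?n) j q) i p" for i
      by (rule partial_cong[OF big_open in_big]) (simp add: pu loc(2))
    then show ?thesis
      unfolding div_A_grad_def using local_pde[where \<mu> = \<mu>, OF in_big[of p] den] by (simp add: u_def)
  qed
  \<comment> \<open>At the origin s = 3/2 rounds to n = 2; the outgoing mode 2 is fully on and mode
    3 is still off.\<close>
  moreover have "u 0 \<noteq> 0"
  proof -
    have s: "slow L 0 = 3/2" by (simp add: slow_def)
    have n: "strip_index L 0 = 2" by (simp add: strip_index_def s)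
    show ?thesis unfolding u_def n
      by (simp add: uloc_def mode_def amp_def cutoff_def side_def s smoothstep_const expo_def)
  qed
  moreover have "\<exists>c C T0. c > 0 \<and> C > 0 \<and>
        (\<forall>T \<ge> T0. \<forall>p. \<bar>p $ 3\<bar> \<ge> T \<longrightarrow> \<bar>u p\<bar> \<le> C * exp (- c * exp (c * T)))"
  proof (intro exI conjI allI impI)
    show "0 < min (L / 20) (ln 2 / L)" using L by auto
    show "0 < (2::real)" by simp
    show "\<bar>u p\<bar> \<le> 2 * exp (- min (L / 20) (ln 2 / L) * exp (min (L / 20) (ln 2 / L) * T))"
      if "0 \<le> T" "T \<le> \<bar>p $ 3\<bar>" for T and p :: "real^3"
      unfolding u_def using u_decay[of L T p] that L by simp
  qed
  ultimately show ?thesis by blast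
qed

end
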